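(* Let $n\ge2$ and let $\mathcal S$ be a subset of $CS_{\rm c.c}(\mathbb R^n)$ such that $CS^{-\infty}_{\rm c.c}(\mathbb R^n)\subset\mathcal S\subset{\rm Ker}({\rm res})$. For every $\sigma\in\mathcal S\cap CS^a_{\rm c.c}(\mathbb R^n)$, $\sigma\sim\sum_{j\ge0}\chi\,\sigma_{a-j}$, there exist (because ${\rm res}(\sigma)=0$) symbols $\tau_i\in CS^{a+1}_{\rm c.c}(\mathbb R^n)$, $\tau_i\sim\sum_{j\ge0}\chi\,\tau_{i,a-j+1}$, $i=1,\dots,n$, such that $\sigma\sim\sum_{i=1}^n\partial_i\tau_i$. Assume that for any $\sigma\in\mathcal S$ the $\tau_i$ and the $\chi\,\tau_{i,a+1-j}$, $j\in\mathbb N_0$, can be chosen in $\mathcal S$. Then any linear form $\rho:\mathcal S\to\mathbb C$ which satisfies Stokes' property is entirely determined by its restriction to $\mathcal S\cap CS^{<-K}_{\rm c.c}(\mathbb R^n)$ for any positive integer $K\le n$. Equivalently, under the same conditions any closed linear form $\widetilde\rho:\Omega\mathcal S\to\mathbb C$ is entirely determined by its restriction to those forms in $\Omega\mathcal S$ whose coefficients lie in $CS^{<-K}_{\rm c.c}(\mathbb R^n)$, for any positive integer $K\le n$. In particular, if the cut-off regularised integral $-\!\!\!\!\!\int_{\mathbb R^n}$ satisfies Stokes' property on $\mathcal S$, and $\rho:\mathcal S\to\mathbb C$ is a linear form satisfying Stokes' property which is continuous on $\mathcal S\cap CS^a_{\rm c.c}(\mathbb R^n)$ for any complex number $a$, then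 there is a constant $c$ such that $\rho=c\cdot -\!\!\!\!\!\int_{\mathbb R^n}$ on $\mathcal S$.
   Context: For $a\in\mathbb C$, $\mathcal S^a_{\rm c.c}(\mathbb R^n)$ is the set of smooth functions $\sigma$ on $\mathbb R^n$ with $|\partial_\xi^\beta\sigma(\xi)|\le C_\beta(1+|\xi|)^{{\rm Re}(a)-|\beta|}$ for all $\beta$. $CS^a_{\rm c.c}(\mathbb R^n)$ (classical symbols of order $a$ with constant coefficients) is the set of $\sigma\in\mathcal S^a_{\rm c.c}(\mathbb R^n)$ such that for every $N$, $\sigma=\sum_{j=0}^{N-1}\chi\,\sigma_{a-j}+\sigma_{(N)}$ with $\sigma_{(N)}\in\mathcal S^{a-N}_{\rm c.c}(\mathbb R^n)$, $\sigma_{a-j}$ smooth on $\mathbb R^n\setminus\{0\}$ and positively homogeneous of degree $a-j$, and $\chi$ a smooth cut-off function vanishing near $0$ and equal to $1$ outside the unit ball; one writes $\sigma\sim\sum_j\chi\,\sigma_{a-j}$. $CS_{\rm c.c}(\mathbb R^n)$ is the algebra generated by all $CS^a_{\rm c.c}(\mathbb R^n)$, $a\in\mathbb C$; $CS^{<p}_{\rm c.c}(\mathbb R^n)=\bigcup_{{\rm Re}(a)<p}CS^a_{\rm c.c}(\mathbb R^n)$; $CS^{-\infty}_{\rm c.c}(\mathbb R^n)=\bigcap_aCS^a_{\rm c.c}(\mathbb R^n)$ is the set of smoothing symbols; $\sigma\sim\sigma'$ between two symbols means $\sigma-\sigma'$ is smoothing. Topology: $CS^a_{\rm c.c}(\mathbb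 R^n)$ carries the Fréchet structure given by the semi-norms $\sup_\xi(1+|\xi|)^{-{\rm Re}(a)+|\beta|}|\partial^\beta\sigma(\xi)|$, $\sup_\xi(1+|\xi|)^{-{\rm Re}(a)+N+|\beta|}|\partial^\beta(\sigma-\sum_{j<N}\chi\sigma_{a-j})(\xi)|$ and $\sup_{|\xi|=1}|\partial^\beta\sigma_{a-j}(\xi)|$. Residue: ${\rm res}(\sigma)=(2\pi)^{-n/2}\int_{S^{n-1}}\sigma_{-n}\,d\mu_S$, where $\sigma_{-n}$ is the homogeneous component of degree $-n$ (zero if there is none). Cut-off regularised integral: for $\sigma\in CS_{\rm c.c}(\mathbb R^n)$, $-\!\!\!\!\!\int_{\mathbb R^n}\sigma(\xi)\,d\xi$ is the constant term in the asymptotic expansion as $R\to\infty$ of $\int_{B(0,R)}\sigma(\xi)\,d\xi$ (in powers $R^{a-j+n}$, $a-j+n\ne0$, and $\log R$). A map $\rho:\mathcal S\to\mathbb C$ is called a linear form if $\rho(\alpha_1\sigma_1+\alpha_2\sigma_2)=\alpha_1\rho(\sigma_1)+\alpha_2\rho(\sigma_2)$ whenever $\sigma_1,\sigma_2,\alpha_1\sigma_1+\alpha_2\sigma_2\in\mathcal S$. It satisfies Stokes' property if $\rho(\sigma)=0$ whenever $\sigma\in\mathcal S$ is of the form $\sigma=\partial_j\tau$ for some $j$ and some $\tau\in CS_{\rm c.c}(\mathbb R^n)$. Forms: $\Omega^k\mathcal S=\{\sum_{|I|=k}\alpha_I(\xi)\,d\xi_I:\alpha_I\in\mathcal S\}$,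 $\Omega\mathcal S=\bigoplus_k\Omega^k\mathcal S$. $\rho$ extends to $\widetilde\rho$ on $\Omega\mathcal S$ by $\widetilde\rho(\alpha\,d\xi_{i_1}\wedge\cdots\wedge d\xi_{i_k})=\rho(\alpha)$ if $k=n$ and $0$ otherwise ($i_1<\dots<i_k$). $\widetilde\rho$ is closed if $\widetilde\rho(\alpha)=0$ for every $\alpha=d\beta\in\Omega^n\mathcal S$ with $\beta$ a classical symbol valued form.
   Formalization: The formal theorem additionally assumes that the τ_i can be chosen so that all sums of ∂_iτ_i over subsets of {1,…,n} lie in S; without this the claim fails, e.g. for n=2 and S = CS^{-∞} ∪ {cχξ^α|ξ|^{1/2}}. *)

theory Defs
  imports "HOL-Analysis.Analysis"
begin

section \<open>Smooth functions\<close>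

definition partial_deriv ::
    "'n \<Rightarrow> (real ^ 'n \<Rightarrow> 'b) \<Rightarrow> real ^ 'n \<Rightarrow> 'b::real_normed_vector"
  where "partial_deriv i f x = frechet_derivative f (at x) (axis i 1)"

text \<open>
  A multi-index is encoded by a list of coordinate indices, its length being the order.
  For smooth functions the order of differentiation is immaterial, so quantifying over all
  lists is the same as quantifying over all multi-indices.
\<close>

definition partial_derivs ::
    "'n list \<Rightarrow> (real ^ 'n \<Rightarrow> 'b) \<Rightarrow> real ^ 'n \<Rightarrow> 'b::real_normed_vector"
  where "partial_derivs \<beta> f = foldr partial_deriv \<beta> f"

definition smooth_on :: "(real ^ 'n) set \<Rightarrow> (real ^ 'n \<Rightarrow> 'b::real_normed_vector) \<Rightarrow> bool"
  where "smooth_on U f \<longleftrightarrow> open U \<and> (\<forall>\<beta>. \<forall>x\<in>U. partial_derivs \<beta> f differentiable (at x))"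


section \<open>Classical symbols with constant coefficients\<close>

definition symbols :: "complex \<Rightarrow> (real ^ 'n \<Rightarrow> complex) set"
  where "symbols a = {\<sigma>. smooth_on UNIV \<sigma> \<and>
    (\<forall>\<beta>. \<exists>C. \<forall>\<xi>. norm (partial_derivs \<beta> \<sigma> \<xi>) \<le> C * (1 + norm \<xi>) powr (Re a - real (length \<beta>)))}"

definition cutoff :: "(real ^ 'n \<Rightarrow> real) \<Rightarrow> bool"
  where "cutoff \<psi> \<longleftrightarrow> smooth_on UNIV \<psi> \<and>
    (\<exists>\<epsilon>>0. \<forall>\<xi>. norm \<xi> < \<epsilon> \<longrightarrow> \<psi> \<xi> = 0) \<and> (\<forall>\<xi>. norm \<xi> \<ge> 1 \<longrightarrow> \<psi> \<xi> = 1)"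

definition pos_homogeneous :: "complex \<Rightarrow> (real ^ 'n \<Rightarrow> complex) \<Rightarrow> bool"
  where "pos_homogeneous b f \<longleftrightarrow>
    (\<forall>t>0. \<forall>\<xi>. \<xi> \<noteq> 0 \<longrightarrow> f (t *\<^sub>R \<xi>) = complex_of_real t powr b * f \<xi>)"

text \<open>\<open>h j\<close> is the component of degree \<open>a - j\<close>; its value at the origin is irrelevant.\<close>

definition has_expansion ::
    "(real ^ 'n \<Rightarrow> real) \<Rightarrow> complex \<Rightarrow> (real ^ 'n \<Rightarrow> complex) \<Rightarrow> (nat \<Rightarrow> real ^ 'n \<Rightarrow> complex) \<Rightarrow> bool"
  where "has_expansion \<psi> a \<sigma> h \<longleftrightarrow>
    (\<forall>j. smooth_on (- {0}) (h j) \<and> pos_homogeneous (a - of_nat j) (h j)) \<and>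
    (\<forall>N. (\<lambda>\<xi>. \<sigma> \<xi> - (\<Sum>j<N. complex_of_real (\<psi> \<xi>) * h j \<xi>)) \<in> symbols (a - of_nat N))"

definition CS :: "complex \<Rightarrow> (real ^ 'n \<Rightarrow> complex) set"
  where "CS a = {\<sigma> \<in> symbols a. \<exists>\<psi> h. cutoff \<psi> \<and> has_expansion \<psi> a \<sigma> h}"

text \<open>The algebra generated by the classical symbols of all orders.\<close>

inductive_set CS_alg :: "(real ^ 'n \<Rightarrow> complex) set" where
  incl: "\<sigma> \<in> CS a \<Longrightarrow> \<sigma> \<in> CS_alg"
| scale: "\<sigma> \<in> CS_alg \<Longrightarrow> (\<lambda>\<xi>. c * \<sigma> \<xi>) \<in> CS_alg"
| add: "\<sigma> \<in> CS_alg \<Longrightarrow> \<tau> \<in> CS_alg \<Longrightarrow> (\<lambda>\<xi>. \<sigma> \<xi> + \<tau> \<xi>) \<in> CS_alg"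
| mult: "\<sigma> \<in> CS_alg \<Longrightarrow> \<tau> \<in> CS_alg \<Longrightarrow> (\<lambda>\<xi>. \<sigma> \<xi> * \<tau> \<xi>) \<in> CS_alg"

definition CS_less :: "real \<Rightarrow> (real ^ 'n \<Rightarrow> complex) set"
  where "CS_less p = (\<Union>a\<in>{a. Re a < p}. CS a)"

definition smoothing :: "(real ^ 'n \<Rightarrow> complex) set"
  where "smoothing = (\<Inter>a. CS a)"

definition symbol_equiv :: "(real ^ 'n \<Rightarrow> complex) \<Rightarrow> (real ^ 'n \<Rightarrow> complex) \<Rightarrow> bool"
    (infix "\<simeq>\<^sub>s" 50)
  where "\<sigma> \<simeq>\<^sub>s \<tau> \<longleftrightarrow> (\<lambda>\<xi>. \<sigma> \<xi> - \<tau> \<xi>) \<in> smoothing"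


section \<open>Fr\'echet topology on symbols of fixed order\<close>

text \<open>
  The homogeneous components of a classical symbol are unique away from the origin and do not
  depend on the cut-off function.
\<close>

definition component :: "complex \<Rightarrow> (real ^ 'n \<Rightarrow> complex) \<Rightarrow> nat \<Rightarrow> real ^ 'n \<Rightarrow> complex"
  where "component a \<sigma> = (SOME h. \<exists>\<psi>. cutoff \<psi> \<and> has_expansion \<psi> a \<sigma> h)"

definition symbol_seminorm :: "real \<Rightarrow> 'n list \<Rightarrow> (real ^ 'n \<Rightarrow> complex) \<Rightarrow> real"
  where "symbol_seminorm m \<beta> f =
    (SUP \<xi>. (1 + norm \<xi>) powr (- m + real (length \<beta>)) * norm (partial_derivs \<beta> f \<xi>))"

definition CS_seminorms ::
    "(real ^ 'n \<Rightarrow> real) \<Rightarrow> complex \<Rightarrow> ((real ^ 'n \<Rightarrow> complex) \<Rightarrow> real) set"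
  where "CS_seminorms \<psi> a =
    range (\<lambda>\<beta>. symbol_seminorm (Re a) \<beta>) \<union>
    range (\<lambda>(N, \<beta>). \<lambda>\<sigma>. symbol_seminorm (Re a - real N) \<beta>
      (\<lambda>\<xi>. \<sigma> \<xi> - (\<Sum>j<N. complex_of_real (\<psi> \<xi>) * component a \<sigma> j \<xi>))) \<union>
    range (\<lambda>(j, \<beta>). \<lambda>\<sigma>. SUP \<xi>\<in>sphere 0 1. norm (partial_derivs \<beta> (component a \<sigma> j) \<xi>))"

definition CS_topology :: "(real ^ 'n \<Rightarrow> real) \<Rightarrow> complex \<Rightarrow> (real ^ 'n \<Rightarrow> complex) topology"
  where "CS_topology \<psi> a = topology_generated_by
    {{\<tau> \<in> CS a. p (\<lambda>\<xi>. \<tau> \<xi> - \<sigma> \<xi>) < e} | p \<sigma> e. p \<in> CS_seminorms \<psi> a \<and> \<sigma> \<in> CS a \<and> e > 0}"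


section \<open>Residue and cut-off regularised integral\<close>

text \<open>
  Surface measure on the unit sphere: the measure of \<open>A\<close> is \<open>n\<close> times the volume of the cone
  \<open>{r \<xi> | 0 < r \<le> 1, \<xi> \<in> A}\<close>. (The origin is a null set.)
\<close>

definition sphere_measure :: "(real ^ 'n) measure"
  where "sphere_measure = scale_measure (of_nat CARD('n))
    (distr (restrict_space lborel (cball 0 1)) borel (\<lambda>\<xi>. \<xi> /\<^sub>R norm \<xi>))"

text \<open>
  An element of the algebra is a finite sum of classical symbols of various orders; its component
  of degree \<open>b\<close> collects the components of degree \<open>b\<close> of the summands (zero if there are none).
  It is unique away from the origin.
\<close>

definition is_component_of_degree ::
    "complex \<Rightarrow> (real ^ 'n \<Rightarrow> complex) \<Rightarrow> (real ^ 'n \<Rightarrow> complex) \<Rightarrow> bool"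
  where "is_component_of_degree b \<sigma> f \<longleftrightarrow> (\<exists>A s. finite A \<and> (\<forall>a\<in>A. s a \<in> CS a) \<and>
    \<sigma> = (\<lambda>\<xi>. \<Sum>a\<in>A. s a \<xi>) \<and>
    f = (\<lambda>\<xi>. \<Sum>a\<in>A. \<Sum>j | a - of_nat j = b. component a (s a) j \<xi>))"

definition component_of_degree ::
    "complex \<Rightarrow> (real ^ 'n \<Rightarrow> complex) \<Rightarrow> real ^ 'n \<Rightarrow> complex"
  where "component_of_degree b \<sigma> = (SOME f. is_component_of_degree b \<sigma> f)"

definition res :: "(real ^ 'n \<Rightarrow> complex) \<Rightarrow> complex"
  where "res \<sigma> = complex_of_real ((2 * pi) powr (- real CARD('n) / 2)) *
    (LINT \<xi>|sphere_measure. component_of_degree (- of_nat CARD('n)) \<sigma> \<xi>)"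

definition ker_res :: "(real ^ 'n \<Rightarrow> complex) set"
  where "ker_res = {\<sigma> \<in> CS_alg. res \<sigma> = 0}"

text \<open>
  \<open>c\<close> is the constant term of the expansion of \<open>F R\<close> at infinity in non-zero complex powers of
  \<open>R\<close> and \<open>log R\<close>. It is unique, and only finitely many powers matter up to terms that tend to zero.
\<close>

definition is_constant_term :: "(real \<Rightarrow> complex) \<Rightarrow> complex \<Rightarrow> bool"
  where "is_constant_term F c \<longleftrightarrow> (\<exists>E C b. finite E \<and> 0 \<notin> E \<and>
    ((\<lambda>R. F R - (\<Sum>e\<in>E. C e * complex_of_real R powr e) - b * complex_of_real (ln R))
      \<longlongrightarrow> c) at_top)"

definition cutoff_integral :: "(real ^ 'n \<Rightarrow> complex) \<Rightarrow> complex"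
  where "cutoff_integral \<sigma> = (THE c. is_constant_term (\<lambda>R. LINT \<xi>:ball 0 R|lborel. \<sigma> \<xi>) c)"


section \<open>Linear forms and Stokes' property\<close>

text \<open>
  \<open>S\<close> is an arbitrary set of symbols, so linearity is only required where it makes sense.
\<close>

definition linear_form_on ::
    "(real ^ 'n \<Rightarrow> complex) set \<Rightarrow> ((real ^ 'n \<Rightarrow> complex) \<Rightarrow> complex) \<Rightarrow> bool"
  where "linear_form_on S \<rho> \<longleftrightarrow> (\<forall>\<alpha>\<^sub>1 \<alpha>\<^sub>2. \<forall>\<sigma>\<^sub>1\<in>S. \<forall>\<sigma>\<^sub>2\<in>S.
    (\<lambda>\<xi>. \<alpha>\<^sub>1 * \<sigma>\<^sub>1 \<xi> + \<alpha>\<^sub>2 * \<sigma>\<^sub>2 \<xi>) \<in> S \<longrightarrow>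
    \<rho> (\<lambda>\<xi>. \<alpha>\<^sub>1 * \<sigma>\<^sub>1 \<xi> + \<alpha>\<^sub>2 * \<sigma>\<^sub>2 \<xi>) = \<alpha>\<^sub>1 * \<rho> \<sigma>\<^sub>1 + \<alpha>\<^sub>2 * \<rho> \<sigma>\<^sub>2)"

definition stokes_on ::
    "(real ^ 'n \<Rightarrow> complex) set \<Rightarrow> ((real ^ 'n \<Rightarrow> complex) \<Rightarrow> complex) \<Rightarrow> bool"
  where "stokes_on S \<rho> \<longleftrightarrow> (\<forall>j. \<forall>\<tau>\<in>CS_alg. partial_deriv j \<tau> \<in> S \<longrightarrow> \<rho> (partial_deriv j \<tau>) = 0)"

text \<open>
  \<open>\<sigma>\<close> is, up to a smoothing symbol, a divergence of symbols \<open>\<tau>\<^sub>i\<close> chosen in \<open>S\<close>, together with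
  the \<open>\<psi> \<tau>\<^sub>i\<^sub>,\<^sub>a\<^sub>+\<^sub>1\<^sub>-\<^sub>j\<close>. If \<open>\<sigma>\<close> has order \<open>a\<close>, take \<open>A = {a}\<close>; in general \<open>\<sigma>\<close> is a finite sum of
  symbols of orders \<open>a \<in> A\<close>.
  The last clause says that the decomposition takes place inside \<open>S\<close>: as \<open>S\<close> need be neither a
  linear space nor stable under differentiation, \<open>\<tau>\<^sub>i \<in> S\<close> alone would not allow a linear form on
  \<open>S\<close> to be applied to the terms \<open>\<partial>\<^sub>i \<tau>\<^sub>i\<close> and their sums.
\<close>

definition divergence_in ::
    "(real ^ 'n \<Rightarrow> real) \<Rightarrow> (real ^ 'n \<Rightarrow> complex) set \<Rightarrow> (real ^ 'n \<Rightarrow> complex) \<Rightarrow> bool"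
  where "divergence_in \<psi> S \<sigma> \<longleftrightarrow> (\<exists>A s \<tau> h. finite A \<and>
    (\<forall>a\<in>A. s a \<in> CS a) \<and> \<sigma> = (\<lambda>\<xi>. \<Sum>a\<in>A. s a \<xi>) \<and>
    (\<forall>a\<in>A. \<forall>i. \<tau> a i \<in> CS (a + 1) \<and> has_expansion \<psi> (a + 1) (\<tau> a i) (h a i)) \<and>
    (\<forall>a\<in>A. s a \<simeq>\<^sub>s (\<lambda>\<xi>. \<Sum>i\<in>UNIV. partial_deriv i (\<tau> a i) \<xi>)) \<and>
    (\<forall>i. (\<lambda>\<xi>. \<Sum>a\<in>A. \<tau> a i \<xi>) \<in> S) \<and>
    (\<forall>a\<in>A. \<forall>i j. (\<lambda>\<xi>. complex_of_real (\<psi> \<xi>) * h a i j \<xi>) \<in> S) \<and>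
    (\<forall>I. (\<lambda>\<xi>. \<Sum>i\<in>I. partial_deriv i (\<lambda>\<eta>. \<Sum>a\<in>A. \<tau> a i \<eta>) \<xi>) \<in> S))"


section \<open>Symbol valued forms\<close>

text \<open>
  The form \<open>\<Sum>\<^sub>I \<alpha>\<^sub>I d\<xi>\<^sub>I\<close> is encoded by its coefficient family \<open>I \<mapsto> \<alpha>\<^sub>I\<close>, where \<open>d\<xi>\<^sub>I\<close> is the wedge
  product of the \<open>d\<xi>\<^sub>i\<close>, \<open>i \<in> I\<close>, in increasing order. The order on the index type is only used for
  this sign convention.
\<close>

type_synonym 'n form = "'n set \<Rightarrow> real ^ 'n \<Rightarrow> complex"

definition forms :: "(real ^ 'n \<Rightarrow> complex) set \<Rightarrow> 'n form set"
  where "forms S = {\<omega>. \<forall>I. \<omega> I \<in> S}"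

definition k_forms :: "nat \<Rightarrow> (real ^ 'n \<Rightarrow> complex) set \<Rightarrow> 'n form set"
  where "k_forms k S = {\<omega>. \<forall>I. if card I = k then \<omega> I \<in> S else \<omega> I = (\<lambda>_. 0)}"

definition ext_deriv :: "'n::{finite,linorder} form \<Rightarrow> 'n form"
  where "ext_deriv \<omega> J =
    (\<lambda>\<xi>. \<Sum>i\<in>J. (- 1) ^ card {k\<in>J. k < i} * partial_deriv i (\<omega> (J - {i})) \<xi>)"

definition form_extension ::
    "((real ^ 'n \<Rightarrow> complex) \<Rightarrow> complex) \<Rightarrow> 'n form \<Rightarrow> complex"
  where "form_extension \<rho> \<omega> = (\<Sum>I\<in>UNIV. if card I = CARD('n) then \<rho> (\<omega> I) else 0)"

definition closed_on ::
    "(real ^ 'n::{finite,linorder} \<Rightarrow> complex) set \<Rightarrow> ('n form \<Rightarrow> complex) \<Rightarrow> bool"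
  where "closed_on S R \<longleftrightarrow>
    (\<forall>\<beta>\<in>forms CS_alg. ext_deriv \<beta> \<in> k_forms CARD('n) S \<longrightarrow> R (ext_deriv \<beta>) = 0)"

end

(*
  Stokes' property and linearity give rho(sigma) = rho(r), where r is the smoothing symbol that remains
  when the divergence of the tau_i is subtracted from sigma. Hence rho is determined by its values on
  smoothing symbols, which have every order. Closed forms reduce to this case: a symbol tau becomes a
  form of degree n - 1, up to the sign of the exterior derivative.

  For the last claim only linearity and Stokes' property are needed, on Schwartz functions r and phi:
  the convolution r * phi differs from r times the integral of phi, and by symmetry from phi times the
  integral of r, by a divergence of Schwartz functions. So rho is a multiple of the integral on
  smoothing symbols. The cut-off integral is linear on S because the constant term is unique and
  exists for derivatives of classical symbols: outside a ball such a derivative is a finite sum of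
  homogeneous functions and an integrable remainder, and for f homogeneous of degree b the integral
  F(R) over 1 <= |x| < R satisfies F(RS) = F(R) + R^(b+n) F(S).
*)
theory Submission
  imports Defs
begin

section \<open>Smooth functions\<close>

text \<open>\<open>S\<close> need be neither a vector space nor stable under differentiation, so a
  linear form may only be applied to functions already known to lie in \<open>S\<close>. This shapes
  the bookkeeping of partial sums for general \<open>S\<close>. The uniqueness argument takes place
  on smoothing symbols because they do form a vector space stable under differentiation.

  A common route to uniqueness on Schwartz functions constructs, for a function of integral zero,
  potentials that still decay rapidly. The symmetry of convolution makes this unnecessary: r(x) -
  r(x - y) is an integral of derivatives along a segment, so averaging it against phi(y) gives a
  divergence whose potentials are superpositions of translates of r. The weights have finite moments
  of all orders, which keeps the potentials Schwartz.

  \<open>cutoff_integral\<close> is a definite description. Before it can be compared with \<rho> as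
  a linear form, a constant term must exist for every element of \<open>S\<close>; the divergence
  decomposition supplies it, since its terms come with explicit expansions.\<close>

lemma partial_derivs_Nil [simp]: "partial_derivs [] f = f"
  by (simp add: partial_derivs_def)

lemma partial_derivs_Cons [simp]: "partial_derivs (i # \<beta>) f = partial_deriv i (partial_derivs \<beta> f)"
  by (simp add: partial_derivs_def)

lemma partial_derivs_append: "partial_derivs (\<beta> @ \<gamma>) f = partial_derivs \<beta> (partial_derivs \<gamma> f)"
  by (simp add: partial_derivs_def)

lemma partial_deriv_eqI:
  assumes "(f has_derivative f') (at x)"
  shows "partial_deriv i f x = f' (axis i 1)"
  using frechet_derivative_at[OF assms] by (simp add: partial_deriv_def)

lemma has_derivative_partial_derivs:
  fixes f :: "real ^ 'n \<Rightarrow> 'b::real_normed_vector"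
  assumes "f differentiable (at x)"
  shows "(f has_derivative (\<lambda>h. \<Sum>i\<in>UNIV. (h $ i) *\<^sub>R partial_deriv i f x)) (at x)"
proof -
  have D: "(f has_derivative frechet_derivative f (at x)) (at x)"
    using assms by (simp add: frechet_derivative_works)
  interpret bounded_linear "frechet_derivative f (at x)"
    using D by (rule has_derivative_bounded_linear)
  have "frechet_derivative f (at x) = (\<lambda>h. \<Sum>i\<in>UNIV. (h $ i) *\<^sub>R partial_deriv i f x)"
  proof
    fix h :: "real ^ 'n"
    have "frechet_derivative f (at x) h = frechet_derivative f (at x) (\<Sum>i\<in>UNIV. (h $ i) *\<^sub>R axis i 1)"
      using basis_expansion[of h] by (simp add: scalar_mult_eq_scaleR)
    also have "\<dots> = (\<Sum>i\<in>UNIV. (h $ i) *\<^sub>R partial_deriv i f x)"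
      by (simp add: sum scaleR partial_deriv_def)
    finally show "frechet_derivative f (at x) h = (\<Sum>i\<in>UNIV. (h $ i) *\<^sub>R partial_deriv i f x)" .
  qed
  with D show ?thesis by simp
qed

lemma smooth_on_differentiable: "smooth_on U f \<Longrightarrow> x \<in> U \<Longrightarrow> f differentiable (at x)"
  unfolding smooth_on_def by (metis partial_derivs_Nil)

lemma smooth_on_partial_derivs: "smooth_on U f \<Longrightarrow> smooth_on U (partial_derivs \<beta> f)"
  unfolding smooth_on_def by (metis partial_derivs_append)

lemma smooth_on_partial_deriv: "smooth_on U f \<Longrightarrow> smooth_on U (partial_deriv i f)"
  using smooth_on_partial_derivs[of U f "[i]"] by simp

lemma smooth_on_continuous_on: "smooth_on U f \<Longrightarrow> continuous_on U f"
  by (meson continuous_at_imp_continuous_on differentiable_imp_continuous_within smooth_on_differentiable)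

lemma partial_deriv_cong_open:
  assumes "open U" "x \<in> U" "\<And>y. y \<in> U \<Longrightarrow> f y = g y"
  shows "partial_deriv i f x = partial_deriv i g x"
proof -
  \<comment> \<open>\<open>frechet_derivative\<close> chooses among the derivatives, so it is enough
    that f and g have the same ones. This covers points where neither is differentiable.\<close>
  have "(f has_derivative D) (at x) \<longleftrightarrow> (g has_derivative D) (at x)" for D
    using assms has_derivative_transform_within_open[of _ D x UNIV U] by (metis (full_types))
  then show ?thesis by (simp add: partial_deriv_def frechet_derivative_def)
qed

lemma partial_derivs_eq_0_open:
  assumes "open U" "x \<in> U" "\<And>y. y \<in> U \<Longrightarrow> f y = 0"
  shows "partial_derivs \<beta> f x = 0"
  using assms(2)
proof (induction \<beta> arbitrary: x)
  case (Cons i \<beta>)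
  have "partial_deriv i (partial_derivs \<beta> f) x = partial_deriv i (\<lambda>_. 0) x"
    using Cons assms(1) by (intro partial_deriv_cong_open[of U]) auto
  also have "\<dots> = 0"
    using partial_deriv_eqI[of "\<lambda>_. 0" "\<lambda>_. 0" x i] by simp
  finally show ?case by simp
qed (use assms in simp)

lemma partial_deriv_bounded_linear:
  assumes "bounded_linear L" "f differentiable (at x)"
  shows "partial_deriv i (\<lambda>x. L (f x)) x = L (partial_deriv i f x)"
proof -
  have "(f has_derivative frechet_derivative f (at x)) (at x)"
    using assms by (simp add: frechet_derivative_works)
  from partial_deriv_eqI[OF bounded_linear.has_derivative[OF assms(1) this], of i]
  show ?thesis by (simp add: partial_deriv_def)
qed

lemma partial_deriv_add:
  assumes "f differentiable (at x)" "g differentiable (at x)"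
  shows "partial_deriv i (\<lambda>x. f x + g x) x = partial_deriv i f x + partial_deriv i g x"
proof -
  have "(f has_derivative frechet_derivative f (at x)) (at x)"
    "(g has_derivative frechet_derivative g (at x)) (at x)"
    using assms by (simp_all add: frechet_derivative_works)
  from partial_deriv_eqI[OF has_derivative_add[OF this], of i]
  show ?thesis by (simp add: partial_deriv_def)
qed

lemma partial_derivs_bounded_linear:
  assumes "bounded_linear L" "smooth_on UNIV f"
  shows "partial_derivs \<beta> (\<lambda>x. L (f x)) = (\<lambda>x. L (partial_derivs \<beta> f x))"
proof (induction \<beta>)
  case (Cons i \<beta>)
  then show ?case
    using assms by (auto simp: smooth_on_def intro!: partial_deriv_bounded_linear ext)
qed simp

text \<open>Differentiability is asked only below the order of \<open>\<beta>\<close>. This is what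
  makes the rule usable inside an induction on the order, before smoothness of the summands is
  known.\<close>

lemma partial_derivs_add:
  assumes "\<And>\<gamma> x. length \<gamma> < length \<beta> \<Longrightarrow> partial_derivs \<gamma> f differentiable (at x)"
    and "\<And>\<gamma> x. length \<gamma> < length \<beta> \<Longrightarrow> partial_derivs \<gamma> g differentiable (at x)"
  shows "partial_derivs \<beta> (\<lambda>x. f x + g x) = (\<lambda>x. partial_derivs \<beta> f x + partial_derivs \<beta> g x)"
  using assms
proof (induction \<beta>)
  case (Cons i \<beta>)
  then show ?case by (auto intro!: partial_deriv_add ext)
qed simp

lemma partial_derivs_add_smooth:
  assumes "smooth_on UNIV f" "smooth_on UNIV g"
  shows "partial_derivs \<beta> (\<lambda>x. f x + g x) = (\<lambda>x. partial_derivs \<beta> f x + partial_derivs \<beta> g x)"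
  using assms by (intro partial_derivs_add) (auto simp: smooth_on_def)

lemma smooth_on_bounded_linear:
  assumes "bounded_linear L" "smooth_on UNIV f"
  shows "smooth_on UNIV (\<lambda>x. L (f x))"
  unfolding smooth_on_def partial_derivs_bounded_linear[OF assms]
  using assms unfolding smooth_on_def differentiable_def by (blast intro: bounded_linear.has_derivative)

lemma smooth_on_add:
  assumes "smooth_on UNIV f" "smooth_on UNIV g"
  shows "smooth_on UNIV (\<lambda>x. f x + g x)"
  using assms by (simp add: smooth_on_def partial_derivs_add_smooth[OF assms])

lemma partial_derivs_const: "partial_derivs \<beta> (\<lambda>x. c) = (\<lambda>x. if \<beta> = [] then c else 0)"
proof (induction \<beta>)
  case (Cons i \<beta>)
  have "partial_deriv i (\<lambda>x. c) x = 0" for c :: 'b and x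
    using partial_deriv_eqI[of "\<lambda>_. c" "\<lambda>_. 0" x i] by simp
  with Cons show ?case by auto
qed simp

lemma smooth_on_const: "smooth_on UNIV (\<lambda>x. c)"
  by (simp add: smooth_on_def partial_derivs_const)

lemma smooth_on_diff:
  assumes "smooth_on UNIV f" "smooth_on UNIV g"
  shows "smooth_on UNIV (\<lambda>x. f x - g x)"
  using smooth_on_add[OF assms(1) smooth_on_bounded_linear[OF bounded_linear_minus[OF bounded_linear_ident] assms(2)]]
  by simp

lemma partial_deriv_bounded_bilinear:
  assumes "bounded_bilinear bil" "f differentiable (at x)" "g differentiable (at x)"
  shows "partial_deriv i (\<lambda>x. bil (f x) (g x)) x
    = bil (partial_deriv i f x) (g x) + bil (f x) (partial_deriv i g x)"
proof -
  have "(f has_derivative frechet_derivative f (at x)) (at x)"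
    "(g has_derivative frechet_derivative g (at x)) (at x)"
    using assms by (simp_all add: frechet_derivative_works)
  from partial_deriv_eqI[OF bounded_bilinear.FDERIV[OF assms(1) this], of i]
  show ?thesis by (simp add: partial_deriv_def add.commute)
qed

text \<open>Peeling off the innermost derivative, the last entry of the list, turns the product by
  Leibniz into a sum of two products of smooth functions with one derivative fewer left to take.
  Induction on a bound for the order, with both factors varying, then avoids the Leibniz formula of
  higher order.\<close>

lemma smooth_on_bounded_bilinear:
  fixes f :: "real ^ 'n \<Rightarrow> 'a::real_normed_vector" and g :: "real ^ 'n \<Rightarrow> 'b::real_normed_vector"
    and bil :: "'a \<Rightarrow> 'b \<Rightarrow> 'c::real_normed_vector"
  assumes bil: "bounded_bilinear bil" and "smooth_on UNIV f" "smooth_on UNIV g"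
  shows "smooth_on UNIV (\<lambda>x. bil (f x) (g x))"
proof -
  have diff: "(\<lambda>x. bil (f x) (g x)) differentiable at x"
    if "smooth_on UNIV f" "smooth_on UNIV g" for f g and x :: "real ^ 'n"
    using smooth_on_differentiable[OF that(1), of x] smooth_on_differentiable[OF that(2), of x]
      bounded_bilinear.FDERIV[OF bil] unfolding differentiable_def by blast
  have "partial_derivs \<beta> (\<lambda>x. bil (f x) (g x)) differentiable at x"
    if "length \<beta> \<le> n" "smooth_on UNIV f" "smooth_on UNIV g" for n \<beta> f g and x :: "real ^ 'n"
    using that
  proof (induction n arbitrary: \<beta> f g x)
    case 0
    then show ?case using diff by simp
  next
    case (Suc n)
    show ?case
    proof (cases \<beta> rule: rev_cases)
      case Nil
      then show ?thesis using diff Suc.prems by simp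
    next
      case (snoc \<gamma> i)
      let ?p = "\<lambda>x. bil (partial_deriv i f x) (g x)" and ?q = "\<lambda>x. bil (f x) (partial_deriv i g x)"
      have IH: "partial_derivs \<delta> ?p differentiable at x" "partial_derivs \<delta> ?q differentiable at x"
        if "length \<delta> \<le> length \<gamma>" for \<delta> x
        using that Suc.prems snoc by (intro Suc.IH; simp add: smooth_on_partial_deriv)+
      have "partial_deriv i (\<lambda>x. bil (f x) (g x)) = (\<lambda>x. ?p x + ?q x)"
        using Suc.prems by (auto intro!: partial_deriv_bounded_bilinear bil smooth_on_differentiable[of UNIV])
      then have "partial_derivs \<beta> (\<lambda>x. bil (f x) (g x)) = partial_derivs \<gamma> (\<lambda>x. ?p x + ?q x)"
        by (simp add: snoc partial_derivs_append)
      also have "\<dots> = (\<lambda>x. partial_derivs \<gamma> ?p x + partial_derivs \<gamma> ?q x)"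
        using IH by (intro partial_derivs_add) auto
      finally show ?thesis using IH by simp
    qed
  qed
  from this[OF order_refl] show ?thesis
    using assms by (simp add: smooth_on_def)
qed

lemma partial_deriv_sum:
  assumes "\<And>a. a \<in> A \<Longrightarrow> f a differentiable (at x)"
  shows "partial_deriv i (\<lambda>x. \<Sum>a\<in>A. f a x) x = (\<Sum>a\<in>A. partial_deriv i (f a) x)"
proof -
  have "((\<lambda>x. \<Sum>a\<in>A. f a x) has_derivative (\<lambda>h. \<Sum>a\<in>A. frechet_derivative (f a) (at x) h)) (at x)"
    using assms by (intro has_derivative_sum) (simp add: frechet_derivative_works)
  from partial_deriv_eqI[OF this] show ?thesis by (simp add: partial_deriv_def)
qed

section \<open>Symbols and smoothing symbols\<close>

lemma symbols_smooth: "f \<in> symbols a \<Longrightarrow> smooth_on UNIV f"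
  by (simp add: symbols_def)

lemma CS_subset_symbols: "CS a \<subseteq> symbols a"
  by (auto simp: CS_def)

lemma symbols_zero: "(\<lambda>_. 0) \<in> symbols a"
  by (auto simp: symbols_def smooth_on_const partial_derivs_const intro!: exI[of _ 0])

lemma symbols_add:
  assumes "f \<in> symbols a" "g \<in> symbols a"
  shows "(\<lambda>\<xi>. f \<xi> + g \<xi>) \<in> symbols a"
proof -
  have "\<exists>C. \<forall>\<xi>. norm (partial_derivs \<beta> (\<lambda>\<xi>. f \<xi> + g \<xi>) \<xi>)
      \<le> C * (1 + norm \<xi>) powr (Re a - real (length \<beta>))" for \<beta>
  proof -
    obtain C D where
      "\<And>\<xi>. norm (partial_derivs \<beta> f \<xi>) \<le> C * (1 + norm \<xi>) powr (Re a - real (length \<beta>))"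
      "\<And>\<xi>. norm (partial_derivs \<beta> g \<xi>) \<le> D * (1 + norm \<xi>) powr (Re a - real (length \<beta>))"
      using assms unfolding symbols_def by blast
    then have "norm (partial_derivs \<beta> (\<lambda>\<xi>. f \<xi> + g \<xi>) \<xi>)
        \<le> (C + D) * (1 + norm \<xi>) powr (Re a - real (length \<beta>))" for \<xi>
      unfolding partial_derivs_add_smooth[OF assms[THEN symbols_smooth]] distrib_right
      by (intro norm_triangle_le add_mono)
    then show ?thesis by blast
  qed
  with assms show ?thesis
    by (simp add: symbols_def smooth_on_add)
qed

lemma symbols_scale:
  assumes "f \<in> symbols a"
  shows "(\<lambda>\<xi>. c * f \<xi>) \<in> symbols a"
proof -
  have "\<exists>C. \<forall>\<xi>. norm (partial_derivs \<beta> (\<lambda>\<xi>. c * f \<xi>) \<xi>)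
      \<le> C * (1 + norm \<xi>) powr (Re a - real (length \<beta>))" for \<beta>
  proof -
    obtain C where
      "\<And>\<xi>. norm (partial_derivs \<beta> f \<xi>) \<le> C * (1 + norm \<xi>) powr (Re a - real (length \<beta>))"
      using assms unfolding symbols_def by blast
    then have "norm (partial_derivs \<beta> (\<lambda>\<xi>. c * f \<xi>) \<xi>)
        \<le> (norm c * C) * (1 + norm \<xi>) powr (Re a - real (length \<beta>))" for \<xi>
      unfolding partial_derivs_bounded_linear[OF bounded_linear_mult_right symbols_smooth[OF assms]]
        norm_mult mult.assoc by (intro mult_left_mono) auto
    then show ?thesis by blast
  qed
  with assms show ?thesis
    by (simp add: symbols_def smooth_on_bounded_linear[OF bounded_linear_mult_right])
qed

lemma symbols_partial_deriv:
  assumes "f \<in> symbols a"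
  shows "partial_deriv i f \<in> symbols (a - 1)"
proof -
  have "\<exists>C. \<forall>\<xi>. norm (partial_derivs \<beta> (partial_deriv i f) \<xi>)
      \<le> C * (1 + norm \<xi>) powr (Re (a - 1) - real (length \<beta>))" for \<beta>
  proof -
    obtain C where
      "\<And>\<xi>. norm (partial_derivs (\<beta> @ [i]) f \<xi>)
        \<le> C * (1 + norm \<xi>) powr (Re a - real (length (\<beta> @ [i])))"
      using assms unfolding symbols_def by blast
    then show ?thesis by (auto simp: partial_derivs_append algebra_simps)
  qed
  with assms show ?thesis
    by (simp add: symbols_def smooth_on_partial_deriv)
qed

lemma CS_alg_differentiable: "f \<in> CS_alg \<Longrightarrow> f differentiable (at x)"
proof (induction rule: CS_alg.induct)
  case (incl \<sigma> a)
  then show ?case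
    using CS_subset_symbols symbols_smooth smooth_on_differentiable by blast
qed auto

lemma CS_alg_continuous: "f \<in> CS_alg \<Longrightarrow> continuous_on UNIV f"
  by (meson CS_alg_differentiable continuous_at_imp_continuous_on differentiable_imp_continuous_within)

text \<open>A symbol of every order has, at each order, the expansion with all components zero:
  every remainder is the function itself. The given \<psi> serves as the cut-off that membership in
  \<open>CS a\<close> asks for.\<close>

lemma smoothing_eq_Inter_symbols:
  fixes \<psi> :: "real ^ 'n \<Rightarrow> real"
  assumes "cutoff \<psi>"
  shows "smoothing = (\<Inter>a. symbols a :: (real ^ 'n \<Rightarrow> complex) set)"
proof -
  have "f \<in> CS a" if "\<forall>a. f \<in> symbols a" for f :: "real ^ 'n \<Rightarrow> complex" and a :: complex
  proof -
    have "has_expansion \<psi> a f (\<lambda>_ _. 0)"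
      using that by (simp add: has_expansion_def pos_homogeneous_def smooth_on_def partial_derivs_const
          open_Compl)
    with assms that show ?thesis unfolding CS_def by blast
  qed
  moreover have "f \<in> symbols a" if "f \<in> CS a" for f :: "real ^ 'n \<Rightarrow> complex" and a
    using that CS_subset_symbols by blast
  ultimately show ?thesis by (auto simp: smoothing_def)
qed

lemma smoothing_in_symbols: "f \<in> smoothing \<Longrightarrow> f \<in> symbols a"
  using CS_subset_symbols by (auto simp: smoothing_def)

lemma smoothing_smooth: "f \<in> smoothing \<Longrightarrow> smooth_on UNIV f"
  by (rule symbols_smooth[OF smoothing_in_symbols])

lemma smoothing_subset_CS_alg: "smoothing \<subseteq> CS_alg"
  by (auto simp: smoothing_def intro: CS_alg.incl)

section \<open>The differential vector space of smoothing symbols\<close>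

context
  fixes \<psi> :: "real ^ 'n \<Rightarrow> real"
  assumes \<psi>: "cutoff \<psi>"
begin

lemma smoothing_zero: "(\<lambda>_ :: real ^ 'n. 0) \<in> smoothing"
  by (simp add: smoothing_eq_Inter_symbols[OF \<psi>] symbols_zero)

lemma smoothing_add:
  fixes f :: "real ^ 'n \<Rightarrow> complex"
  shows "f \<in> smoothing \<Longrightarrow> g \<in> smoothing \<Longrightarrow> (\<lambda>\<xi>. f \<xi> + g \<xi>) \<in> smoothing"
  by (simp add: smoothing_eq_Inter_symbols[OF \<psi>] symbols_add)

lemma smoothing_scale:
  fixes f :: "real ^ 'n \<Rightarrow> complex"
  shows "f \<in> smoothing \<Longrightarrow> (\<lambda>\<xi>. c * f \<xi>) \<in> smoothing"
  by (simp add: smoothing_eq_Inter_symbols[OF \<psi>] symbols_scale)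

lemma smoothing_partial_deriv:
  fixes f :: "real ^ 'n \<Rightarrow> complex"
  assumes "f \<in> smoothing"
  shows "partial_deriv i f \<in> smoothing"
proof -
  have "partial_deriv i f \<in> symbols a" for a
    using symbols_partial_deriv[OF smoothing_in_symbols[OF assms, of "a + 1"]] by simp
  then show ?thesis by (simp add: smoothing_eq_Inter_symbols[OF \<psi>])
qed

lemma smoothing_sum:
  fixes f :: "'b \<Rightarrow> real ^ 'n \<Rightarrow> complex"
  shows "(\<And>a. a \<in> A \<Longrightarrow> f a \<in> smoothing) \<Longrightarrow> (\<lambda>\<xi>. \<Sum>a\<in>A. f a \<xi>) \<in> smoothing"
  by (induction A rule: infinite_finite_induct) (simp_all add: smoothing_zero smoothing_add)

text \<open>Collects the data over all orders into one vector field \<open>T\<close> and one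
  smoothing remainder \<open>r\<close>. The memberships in \<open>S\<close> serve the linear forms.
  The last conclusion keeps the summands of different orders apart, since their sum has in general
  no single expansion in steps of one; it serves the existence of constant terms.\<close>

lemma divergence_in_decomposition:
  assumes "divergence_in \<psi> S \<sigma>"
  obtains T r where "r \<in> smoothing" "\<And>i. T i \<in> S"
    "\<And>I. (\<lambda>\<xi>. \<Sum>i\<in>I. partial_deriv i (T i) \<xi>) \<in> S"
    "\<sigma> = (\<lambda>\<xi>. r \<xi> + (\<Sum>i\<in>UNIV. partial_deriv i (T i) \<xi>))"
    "\<And>i. \<exists>(A :: complex set) \<tau>. finite A \<and> (\<forall>a\<in>A. \<exists>b h. \<tau> a \<in> CS b \<and> has_expansion \<psi> b (\<tau> a) h) \<and>
      partial_deriv i (T i) = (\<lambda>\<xi>. \<Sum>a\<in>A. partial_deriv i (\<tau> a) \<xi>)"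
proof -
  obtain A s \<tau> h where A: "finite A" and \<sigma>: "\<sigma> = (\<lambda>\<xi>. \<Sum>a\<in>A. s a \<xi>)"
    and \<tau>: "\<forall>a\<in>A. \<forall>i. \<tau> a i \<in> CS (a + 1) \<and> has_expansion \<psi> (a + 1) (\<tau> a i) (h a i)"
    and s: "\<forall>a\<in>A. s a \<simeq>\<^sub>s (\<lambda>\<xi>. \<Sum>i\<in>UNIV. partial_deriv i (\<tau> a i) \<xi>)"
    and TS: "\<forall>i. (\<lambda>\<xi>. \<Sum>a\<in>A. \<tau> a i \<xi>) \<in> S"
    and DS: "\<forall>I. (\<lambda>\<xi>. \<Sum>i\<in>I. partial_deriv i (\<lambda>\<eta>. \<Sum>a\<in>A. \<tau> a i \<eta>) \<xi>) \<in> S"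
    using assms unfolding divergence_in_def by (elim exE conjE) (rule that; assumption)
  have deriv_T: "partial_deriv i (\<lambda>\<xi>. \<Sum>a\<in>A. \<tau> a i \<xi>) = (\<lambda>\<xi>. \<Sum>a\<in>A. partial_deriv i (\<tau> a i) \<xi>)" for i
  proof
    fix \<xi>
    have "\<tau> a i differentiable (at \<xi>)" if "a \<in> A" for a
      using \<tau> that CS_subset_symbols symbols_smooth smooth_on_differentiable by blast
    then show "partial_deriv i (\<lambda>\<xi>. \<Sum>a\<in>A. \<tau> a i \<xi>) \<xi> = (\<Sum>a\<in>A. partial_deriv i (\<tau> a i) \<xi>)"
      by (rule partial_deriv_sum)
  qed
  define r where "r = (\<lambda>\<xi>. \<Sum>a\<in>A. s a \<xi> - (\<Sum>i\<in>UNIV. partial_deriv i (\<tau> a i) \<xi>))"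
  have r: "r \<in> smoothing"
    unfolding r_def using s by (intro smoothing_sum) (simp add: symbol_equiv_def)
  have \<sigma>r: "\<sigma> = (\<lambda>\<xi>. r \<xi> + (\<Sum>i\<in>UNIV. partial_deriv i (\<lambda>\<xi>. \<Sum>a\<in>A. \<tau> a i \<xi>) \<xi>))"
    unfolding deriv_T by (subst sum.swap) (simp add: \<sigma> r_def sum_subtractf)
  have ex: "\<exists>(B :: complex set) \<tau>'. finite B \<and>
      (\<forall>a\<in>B. \<exists>b h. \<tau>' a \<in> CS b \<and> has_expansion \<psi> b (\<tau>' a) h) \<and>
      partial_deriv i (\<lambda>\<xi>. \<Sum>a\<in>A. \<tau> a i \<xi>) = (\<lambda>\<xi>. \<Sum>a\<in>B. partial_deriv i (\<tau>' a) \<xi>)" for i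
    by (rule exI[of _ A], rule exI[of _ "\<lambda>a. \<tau> a i"]) (use A \<tau> deriv_T in blast)
  show thesis
    by (rule that[OF r spec[OF TS] spec[OF DS] \<sigma>r ex])
qed

end

section \<open>Linear forms with Stokes' property\<close>

lemma linear_form_on_add:
  assumes "linear_form_on S \<rho>" "f \<in> S" "g \<in> S" "(\<lambda>\<xi>. f \<xi> + g \<xi>) \<in> S"
  shows "\<rho> (\<lambda>\<xi>. f \<xi> + g \<xi>) = \<rho> f + \<rho> g"
  using assms(1)[unfolded linear_form_on_def, rule_format, OF assms(2,3), of 1 1] assms(4) by simp

lemma linear_form_on_scale:
  assumes "linear_form_on S \<rho>" "f \<in> S" "(\<lambda>\<xi>. c * f \<xi>) \<in> S"
  shows "\<rho> (\<lambda>\<xi>. c * f \<xi>) = c * \<rho> f"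
  using assms(1)[unfolded linear_form_on_def, rule_format, OF assms(2,2), of c 0] assms(3) by simp

text \<open>Each step of the induction applies additivity to a partial sum, and \<open>S\<close>
  need not contain it by itself, hence the hypothesis on all subsets. The empty subset puts the zero
  function into \<open>S\<close>, where scaling by 0 gives the value 0.\<close>

lemma linear_form_on_sum:
  assumes "linear_form_on S \<rho>" "finite I" "\<And>J. J \<subseteq> I \<Longrightarrow> (\<lambda>\<xi>. \<Sum>i\<in>J. f i \<xi>) \<in> S"
  shows "\<rho> (\<lambda>\<xi>. \<Sum>i\<in>I. f i \<xi>) = (\<Sum>i\<in>I. \<rho> (f i))"
  using assms(2,3)
proof (induction I)
  case empty
  then show ?case
    using linear_form_on_scale[OF assms(1), of "\<lambda>_. 0" 0] by simp
next
  case (insert i I)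
  have "\<rho> (\<lambda>\<xi>. f i \<xi> + (\<Sum>i\<in>I. f i \<xi>)) = \<rho> (f i) + \<rho> (\<lambda>\<xi>. \<Sum>i\<in>I. f i \<xi>)"
    using insert.prems[of "{i}"] insert.prems[of I, OF subset_insertI]
      insert.prems[of "insert i I", OF order_refl] insert.hyps
    by (intro linear_form_on_add[OF assms(1)]) simp_all
  moreover have "\<rho> (\<lambda>\<xi>. \<Sum>i\<in>I. f i \<xi>) = (\<Sum>i\<in>I. \<rho> (f i))"
    by (intro insert.IH insert.prems) blast
  ultimately show ?case
    using insert.hyps by simp
qed

lemma stokes_determined_by_smoothing:
  assumes "cutoff \<psi>" "smoothing \<subseteq> S" "S \<subseteq> CS_alg" "\<sigma> \<in> S" "divergence_in \<psi> S \<sigma>"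
    and "linear_form_on S \<rho>\<^sub>1" "stokes_on S \<rho>\<^sub>1" "linear_form_on S \<rho>\<^sub>2" "stokes_on S \<rho>\<^sub>2"
    and "\<And>r. r \<in> smoothing \<Longrightarrow> \<rho>\<^sub>1 r = \<rho>\<^sub>2 r"
  shows "\<rho>\<^sub>1 \<sigma> = \<rho>\<^sub>2 \<sigma>"
proof -
  obtain T r where r: "r \<in> smoothing" and T: "\<And>i. T i \<in> S"
    and D: "\<And>I. (\<lambda>\<xi>. \<Sum>i\<in>I. partial_deriv i (T i) \<xi>) \<in> S"
    and \<sigma>: "\<sigma> = (\<lambda>\<xi>. r \<xi> + (\<Sum>i\<in>UNIV. partial_deriv i (T i) \<xi>))"
    by (rule divergence_in_decomposition[OF assms(1,5)]) blast
  have "\<rho> \<sigma> = \<rho> r" if "linear_form_on S \<rho>" "stokes_on S \<rho>" for \<rho>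
  proof -
    \<comment> \<open>The singleton \<open>{i}\<close> in \<open>D\<close> puts the single
      derivative into \<open>S\<close>, as Stokes' property requires.\<close>
    have "\<rho> (partial_deriv i (T i)) = 0" for i
      using that(2) T[of i] D[of "{i}"] assms(3) by (auto simp: stokes_on_def)
    then have "\<rho> (\<lambda>\<xi>. \<Sum>i\<in>UNIV. partial_deriv i (T i) \<xi>) = 0"
      using linear_form_on_sum[OF that(1), of UNIV "\<lambda>i. partial_deriv i (T i)"] D by simp
    moreover have "\<rho> \<sigma> = \<rho> r + \<rho> (\<lambda>\<xi>. \<Sum>i\<in>UNIV. partial_deriv i (T i) \<xi>)"
      unfolding \<sigma> using r assms(2,4) \<sigma> by (intro linear_form_on_add[OF that(1)] D) auto
    ultimately show ?thesis by simp
  qed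
  from this[OF assms(6,7)] this[OF assms(8,9)] assms(10)[OF r] show ?thesis by simp
qed

section \<open>From closed forms to Stokes' property\<close>

lemma closed_on_imp_stokes_on:
  fixes S :: "(real ^ 'n::{finite,linorder} \<Rightarrow> complex) set"
  assumes "(\<lambda>_ :: (real, 'n) vec. 0) \<in> CS_alg" "closed_on S (form_extension \<rho>)"
  shows "stokes_on S \<rho>"
  unfolding stokes_on_def
proof (intro allI ballI impI)
  fix j and \<tau> :: "(real, 'n) vec \<Rightarrow> complex"
  assume \<tau>: "\<tau> \<in> CS_alg" and S: "partial_deriv j \<tau> \<in> S"
  \<comment> \<open>\<open>e\<close> is the sign that \<open>ext_deriv\<close> attaches to the index
    j when \<open>J = UNIV\<close>. Putting it into the coefficient as well makes the signs cancel,
    so that the top coefficient of the derivative is exactly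
    \<open>partial_deriv j \<tau>\<close>.\<close>
  define e :: complex where "e = (-1) ^ card {k. k < j}"
  have e: "e * e = 1" 
    unfolding e_def power_mult_distrib[symmetric] by simp
  define \<beta> :: "'n form" where "\<beta> = (\<lambda>I. if I = UNIV - {j} then \<lambda>\<xi>. e * \<tau> \<xi> else (\<lambda>_. 0))"
  have zero: "partial_deriv i (\<lambda>_. 0) \<xi> = (0::complex)" for i and \<xi> :: "(real, 'n) vec"
    by (rule partial_deriv_eqI[OF has_derivative_const])
  have d\<tau>: "partial_deriv i (\<lambda>\<xi>. e * \<tau> \<xi>) \<xi> = e * partial_deriv i \<tau> \<xi>" for i \<xi>
    by (intro partial_deriv_bounded_linear bounded_linear_mult_right CS_alg_differentiable \<tau>)
  have d\<beta>: "ext_deriv \<beta> J = (if J = UNIV then partial_deriv j \<tau> else (\<lambda>_. 0))" for J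
  proof (cases "J = UNIV")
    case True
    have eq: "UNIV - {i} = UNIV - {j} \<longleftrightarrow> i = j" for i :: 'n by auto
    have "ext_deriv \<beta> UNIV \<xi> = (\<Sum>i\<in>UNIV. if i = j then e * (e * partial_deriv i \<tau> \<xi>) else 0)" for \<xi>
      unfolding ext_deriv_def \<beta>_def eq
      by (intro sum.cong refl) (auto simp: d\<tau> zero simp flip: e_def)
    also have "\<dots> \<xi> = (e * e) * partial_deriv j \<tau> \<xi>" for \<xi>
      by (simp only: sum.delta finite UNIV_I if_True mult.assoc)
    finally show ?thesis using True e by (simp add: fun_eq_iff)
  next
    case False
    \<comment> \<open>The left side misses i, so equality would force \<open>i = j\<close>, and then
      \<open>J = UNIV\<close>.\<close>
    have "J - {i} \<noteq> UNIV - {j}" if "i \<in> J" for i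
      using False that by blast
    then show ?thesis using False by (auto simp: ext_deriv_def \<beta>_def zero)
  qed
  \<comment> \<open>Every coefficient of a form must be a symbol, including the vanishing ones; this
    is where the zero function has to belong to the algebra.\<close>
  have "\<beta> \<in> forms CS_alg"
    using assms(1) \<tau> by (auto simp: forms_def \<beta>_def intro: CS_alg.scale)
  moreover have "card I = CARD('n) \<longleftrightarrow> I = UNIV" for I :: "'n set"
    using card_subset_eq[of UNIV I] by auto
  moreover from this have "ext_deriv \<beta> \<in> k_forms CARD('n) S"
    using S by (auto simp: k_forms_def d\<beta>)
  ultimately show "\<rho> (partial_deriv j \<tau>) = 0"
    using assms(2) by (auto simp: closed_on_def form_extension_def d\<beta>)
qed

lemma form_extension_eq:
  fixes \<omega> :: "'n::{finite,linorder} form"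
  shows "form_extension \<rho> \<omega> = \<rho> (\<omega> UNIV)"
proof -
  have "card I = CARD('n) \<longleftrightarrow> I = UNIV" for I :: "'n set"
    using card_subset_eq[of UNIV I] by auto
  then show ?thesis by (simp add: form_extension_def)
qed

section \<open>Integrals depending on a parameter\<close>

text \<open>Where the norm of x lies between k and k + 1, the function is at most C / (1 + k)^(d +
  2), d being the dimension. Each such shell is enlarged to the ball of radius 1 + k, whose volume
  grows like (1 + k)^d, and a multiple of the convergent series of 1 / (k + 1)^2 remains. The
  exponent d + 2 pays for using balls in place of shells.\<close>

lemma integrable_decay:
  fixes f :: "'a::euclidean_space \<Rightarrow> 'b::{banach, second_countable_topology}"
  assumes [measurable]: "f \<in> borel_measurable borel"
    and bound: "\<And>x. (1 + norm x) ^ (DIM('a) + 2) * norm (f x) \<le> C"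
  shows "integrable lborel f"
proof -
  define c where "c = (\<lambda>k. C / (1 + real k) ^ (DIM('a) + 2))"
  have "0 \<le> (1 + norm (0::'a)) ^ (DIM('a) + 2) * norm (f 0)" by simp
  also have "\<dots> \<le> C" by (rule bound)
  finally have C: "C \<ge> 0" .
  have "(\<integral>\<^sup>+x. ennreal (norm (f x)) \<partial>lborel)
      \<le> (\<integral>\<^sup>+x. (\<Sum>k. ennreal (c k) * indicator (ball (0::'a) (1 + real k)) x) \<partial>lborel)"
  proof (rule nn_integral_mono)
    fix x :: 'a
    define k where "k = nat \<lfloor>norm x\<rfloor>"
    have k: "real k \<le> norm x" "norm x < 1 + real k"
      unfolding k_def by (simp_all, linarith)
    have "(1 + real k) ^ (DIM('a) + 2) * norm (f x) \<le> (1 + norm x) ^ (DIM('a) + 2) * norm (f x)"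
      using k by (intro mult_right_mono power_mono) auto
    also have "\<dots> \<le> C" by (rule bound)
    finally have "norm (f x) \<le> c k"
      by (simp add: c_def pos_le_divide_eq mult.commute)
    then have "ennreal (norm (f x)) \<le> (\<Sum>j\<in>{k}. ennreal (c j) * indicator (ball 0 (1 + real j)) x)"
      using k by (simp add: ennreal_leI)
    also have "\<dots> \<le> (\<Sum>j. ennreal (c j) * indicator (ball 0 (1 + real j)) x)"
      by (rule sum_le_suminf) auto
    finally show "ennreal (norm (f x)) \<le> (\<Sum>j. ennreal (c j) * indicator (ball 0 (1 + real j)) x)" .
  qed
  also have "\<dots> = (\<Sum>k. ennreal (c k) * emeasure lborel (ball (0::'a) (1 + real k)))"
  proof (subst nn_integral_suminf)
    have [measurable]: "ball (0::'a) r \<in> sets borel" for r by simp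
    show "(\<lambda>x::'a. ennreal (c i) * indicator (ball 0 (1 + real i)) x) \<in> borel_measurable lborel" for i
      by measurable
  qed (simp add: nn_integral_cmult_indicator)
  also have "\<dots> = (\<Sum>k. ennreal (C * unit_ball_vol (real DIM('a)) * inverse (real (Suc k) ^ 2)))"
  proof (rule arg_cong[of _ _ suminf], rule ext)
    fix k
    have "c k * (unit_ball_vol (real DIM('a)) * (1 + real k) ^ DIM('a))
        = C * unit_ball_vol (real DIM('a)) * inverse (real (Suc k) ^ 2)"
    proof -
      have cancel: "(C / (p * q)) * (V * p) = C * V * inverse q" if "p \<noteq> 0" for p q V :: real
        using that by (simp add: divide_inverse mult_ac)
      have "real (Suc k) = 1 + real k" by simp
      then show ?thesis
        unfolding c_def power_add by (simp only:) (rule cancel, simp)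
    qed
    moreover have "c k \<ge> 0" using C by (simp add: c_def)
    ultimately show "ennreal (c k) * emeasure lborel (ball (0::'a) (1 + real k))
        = ennreal (C * unit_ball_vol (real DIM('a)) * inverse (real (Suc k) ^ 2))"
      by (simp only: emeasure_ball[of "1 + real k"] ennreal_mult'[symmetric])
  qed
  also have "\<dots> < \<infinity>"
  proof -
    have "summable (\<lambda>k. inverse (real (Suc k) ^ 2))"
      using summable_ignore_initial_segment[OF inverse_power_summable[of 2, where 'a=real], of 1] by simp
    then have "summable (\<lambda>k. C * unit_ball_vol (real DIM('a)) * inverse (real (Suc k) ^ 2))"
      by (rule summable_mult)
    then have "(\<Sum>k. ennreal (C * unit_ball_vol (real DIM('a)) * inverse (real (Suc k) ^ 2))) \<noteq> top"
      by (rule ennreal_suminf_neq_top) (simp add: C)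
    then show ?thesis by (simp add: less_top)
  qed
  finally show ?thesis by (simp add: integrable_iff_bounded)
qed

section \<open>Differentiation under the integral sign\<close>

lemma bounded_derivs_Lipschitz:
  fixes g :: "real ^ 'n \<Rightarrow> 'b::real_normed_vector"
  assumes "smooth_on UNIV g" "\<And>i x. norm (partial_deriv i g x) \<le> B"
  shows "norm (g x - g y) \<le> real CARD('n) * B * norm (x - y)"
proof (rule differentiable_bound[of UNIV g "\<lambda>x h. \<Sum>i\<in>UNIV. (h $ i) *\<^sub>R partial_deriv i g x"])
  fix x
  show "(g has_derivative (\<lambda>h. \<Sum>i\<in>UNIV. (h $ i) *\<^sub>R partial_deriv i g x)) (at x within UNIV)"
    using assms(1) by (auto intro: has_derivative_partial_derivs smooth_on_differentiable)
  show "onorm (\<lambda>h. \<Sum>i\<in>UNIV. (h $ i) *\<^sub>R partial_deriv i g x) \<le> real CARD('n) * B"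
  proof (rule onorm_le)
    fix h :: "real ^ 'n"
    have "norm (\<Sum>i\<in>UNIV. (h $ i) *\<^sub>R partial_deriv i g x) \<le> (\<Sum>i\<in>(UNIV::'n set). norm h * B)"
      by (intro sum_norm_le) (auto simp: intro!: mult_mono component_le_norm_cart assms)
    then show "norm (\<Sum>i\<in>UNIV. (h $ i) *\<^sub>R partial_deriv i g x) \<le> real CARD('n) * B * norm h"
      by (simp add: mult_ac)
  qed
qed auto

text \<open>Each first derivative is Lipschitz with constant n B, so the differential varies by at
  most n * n B times the distance, and the linearised mean value inequality applies. What matters
  later is that the quadratic bound is uniform in x, not the size of the constant.\<close>

lemma bounded_derivs_Taylor:
  fixes g :: "real ^ 'n \<Rightarrow> 'b::real_normed_vector"
  assumes "smooth_on UNIV g" "\<And>i j x. norm (partial_deriv j (partial_deriv i g) x) \<le> B"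
  shows "norm (g (x + h) - g x - (\<Sum>i\<in>UNIV. (h $ i) *\<^sub>R partial_deriv i g x))
    \<le> real CARD('n) ^ 2 * B * norm h ^ 2"
proof -
  let ?D = "\<lambda>x h. \<Sum>i\<in>UNIV. (h $ i) *\<^sub>R partial_deriv i g x"
  have "norm (g (x + h) - g x - ?D x (x + h - x)) \<le> norm (x + h - x) * (real CARD('n) ^ 2 * B * norm h)"
  proof (rule differentiable_bound_linearization[where S = "cball x (norm h)"])
    fix y assume y: "y \<in> cball x (norm h)"
    show "(g has_derivative ?D y) (at y within cball x (norm h))"
      using assms(1)
      by (rule has_derivative_at_withinI[OF has_derivative_partial_derivs[OF smooth_on_differentiable]])
        simp_all
    show "onorm (?D y - ?D x) \<le> real CARD('n) ^ 2 * B * norm h"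
    proof (rule onorm_le)
      fix k :: "real ^ 'n"
      have "norm (partial_deriv i g y - partial_deriv i g x) \<le> real CARD('n) * B * norm h" for i
      proof -
        have "norm (partial_deriv i g y - partial_deriv i g x) \<le> real CARD('n) * B * norm (y - x)"
          by (intro bounded_derivs_Lipschitz smooth_on_partial_deriv assms)
        \<comment> \<open>The instance at \<open>undefined\<close> indices serves only to obtain
          \<open>B \<ge> 0\<close>.\<close>
        also have "\<dots> \<le> real CARD('n) * B * norm h"
          using y order_trans[OF norm_ge_zero assms(2)[of undefined undefined x]]
          by (intro mult_left_mono) (auto simp: dist_norm norm_minus_commute)
        finally show ?thesis .
      qed
      then have "norm (\<Sum>i\<in>UNIV. (k $ i) *\<^sub>R (partial_deriv i g y - partial_deriv i g x))
          \<le> (\<Sum>i\<in>(UNIV::'n set). norm k * (real CARD('n) * B * norm h))"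
        by (intro sum_norm_le) (auto intro!: mult_mono component_le_norm_cart)
      then show "norm ((?D y - ?D x) k) \<le> real CARD('n) ^ 2 * B * norm h * norm k"
        by (simp add: fun_diff_def scaleR_diff_right sum_subtractf power2_eq_square mult_ac)
    qed
  next
    show "x + t *\<^sub>R (x + h - x) \<in> cball x (norm h)" if "t \<in> {0..1}" for t
      using that by (auto simp: dist_norm mult_left_le_one_le)
  qed auto
  then show ?thesis by (simp add: power2_eq_square mult_ac)
qed

lemma borel_measurable_smooth:
  fixes g :: "real ^ 'n \<Rightarrow> complex"
  shows "smooth_on UNIV g \<Longrightarrow> g \<in> borel_measurable borel"
  by (rule borel_measurable_continuous_onI[OF smooth_on_continuous_on])

text \<open>The Taylor remainder of g is quadratic in h uniformly in the base point. Integrated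
  against the integrable weight w it stays quadratic, so no limit has to be exchanged with an
  integral. The general measure and the general shift v allow superpositions over pairs (y, s) with
  shift s y, where s runs through the unit interval.\<close>

lemma has_derivative_convolution:
  fixes g :: "real ^ 'n \<Rightarrow> complex"
  assumes w: "integrable M w" and v: "v \<in> borel_measurable M"
    and g: "smooth_on UNIV g" "\<And>\<beta>. \<exists>B. \<forall>x. norm (partial_derivs \<beta> g x) \<le> B"
  shows "((\<lambda>x. \<integral>\<omega>. w \<omega> * g (x - v \<omega>) \<partial>M) has_derivative
    (\<lambda>h. \<Sum>i\<in>UNIV. (h $ i) *\<^sub>R (\<integral>\<omega>. w \<omega> * partial_deriv i g (x - v \<omega>) \<partial>M))) (at x)"
proof -
  have int: "integrable M (\<lambda>\<omega>. w \<omega> * partial_derivs \<beta> g (y - v \<omega>))" for \<beta> y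
  proof -
    obtain B where B: "norm (partial_derivs \<beta> g x) \<le> B" for x using g(2) by blast
    have [measurable]: "partial_derivs \<beta> g \<in> borel_measurable borel"
      by (intro borel_measurable_smooth smooth_on_partial_derivs g)
    have [measurable]: "w \<in> borel_measurable M" "v \<in> borel_measurable M" using w v by auto
    show ?thesis
    proof (rule Bochner_Integration.integrable_bound)
      show "integrable M (\<lambda>\<omega>. of_real B * w \<omega>)" using w by simp
      have "norm (w \<omega> * partial_derivs \<beta> g (y - v \<omega>)) \<le> norm (of_real B * w \<omega>)" for \<omega>
        using mult_right_mono[OF B norm_ge_zero] order_trans[OF norm_ge_zero B]
        by (simp add: norm_mult mult.commute[of "norm (w \<omega>)"])
      then show "AE \<omega> in M. norm (w \<omega> * partial_derivs \<beta> g (y - v \<omega>)) \<le> norm (of_real B * w \<omega>)"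
        by simp
    qed measurable
  qed
  \<comment> \<open>The bounds depend on the pair of indices; their sum over all pairs is one
    constant that serves for every pair.\<close>
  have "\<exists>B. \<forall>i j x. norm (partial_deriv j (partial_deriv i g) x) \<le> B"
  proof -
    obtain b where b: "\<And>\<beta> x. norm (partial_derivs \<beta> g x) \<le> b \<beta>" using g(2) by metis
    have "norm (partial_deriv j (partial_deriv i g) x) \<le> (\<Sum>i\<in>UNIV. \<Sum>j\<in>UNIV. b [j, i])" for i j x
    proof -
      have nonneg: "b \<beta> \<ge> 0" for \<beta> using order_trans[OF norm_ge_zero b] .
      have "norm (partial_deriv j (partial_deriv i g) x) \<le> b [j, i]" using b[of "[j, i]"] by simp
      also have "\<dots> \<le> (\<Sum>j\<in>UNIV. b [j, i])" by (rule member_le_sum) (use nonneg in auto)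
      also have "\<dots> \<le> (\<Sum>i\<in>UNIV. \<Sum>j\<in>UNIV. b [j, i])"
        by (rule member_le_sum[of i UNIV "\<lambda>i. \<Sum>j\<in>UNIV. b [j, i]"]) (auto intro: sum_nonneg nonneg)
      finally show ?thesis .
    qed
    then show ?thesis by blast
  qed
  then obtain B where B: "\<And>i j x. norm (partial_deriv j (partial_deriv i g) x) \<le> B" by blast
  define K where "K = real CARD('n) ^ 2 * B * (\<integral>\<omega>. norm (w \<omega>) \<partial>M)"
  let ?G = "\<lambda>x. \<integral>\<omega>. w \<omega> * g (x - v \<omega>) \<partial>M"
  let ?D = "\<lambda>h. \<Sum>i\<in>UNIV. (h $ i) *\<^sub>R (\<integral>\<omega>. w \<omega> * partial_deriv i g (x - v \<omega>) \<partial>M)"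
  have bound: "norm (?G (x + h) - ?G x - ?D h) \<le> K * norm h ^ 2" for h
  proof -
    let ?d = "\<lambda>\<omega>. g (x - v \<omega> + h) - g (x - v \<omega>) - (\<Sum>i\<in>UNIV. (h $ i) *\<^sub>R partial_deriv i g (x - v \<omega>))"
    have eq: "x + h - v \<omega> = x - v \<omega> + h" for \<omega> by simp
    have int': "integrable M (\<lambda>\<omega>. w \<omega> * g (x - v \<omega> + h))" "integrable M (\<lambda>\<omega>. w \<omega> * g (x - v \<omega>))"
      "integrable M (\<lambda>\<omega>. (h $ i) *\<^sub>R (w \<omega> * partial_deriv i g (x - v \<omega>)))" for i
      using int[of "[]" "x + h"] int[of "[]" x] int[of "[i]" x] by (simp_all add: eq)
    have d: "w \<omega> * ?d \<omega> = w \<omega> * g (x - v \<omega> + h) - w \<omega> * g (x - v \<omega>)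
        - (\<Sum>i\<in>UNIV. (h $ i) *\<^sub>R (w \<omega> * partial_deriv i g (x - v \<omega>)))" for \<omega>
      by (simp add: right_diff_distrib sum_distrib_left)
    have intd: "integrable M (\<lambda>\<omega>. w \<omega> * ?d \<omega>)"
      unfolding d using int' by (intro Bochner_Integration.integrable_diff integrable_sum) auto
    have "?G (x + h) - ?G x - ?D h = (\<integral>\<omega>. w \<omega> * ?d \<omega> \<partial>M)"
      unfolding d using int' by (simp add: eq integral_sum)
    also have "norm \<dots> \<le> (\<integral>\<omega>. norm (w \<omega> * ?d \<omega>) \<partial>M)"
      by (rule integral_norm_bound)
    also have "\<dots> \<le> (\<integral>\<omega>. norm (w \<omega>) * (real CARD('n) ^ 2 * B * norm h ^ 2) \<partial>M)"
    proof (rule integral_mono)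
      show "norm (w \<omega> * ?d \<omega>) \<le> norm (w \<omega>) * (real CARD('n) ^ 2 * B * norm h ^ 2)" for \<omega>
        unfolding norm_mult by (intro mult_left_mono bounded_derivs_Taylor[OF g(1) B] norm_ge_zero)
    qed (use integrable_norm[OF intd] integrable_norm[OF w] in simp_all)
    also have "\<dots> = K * norm h ^ 2" by (simp add: K_def)
    finally show ?thesis .
  qed
  show ?thesis
    unfolding has_derivative_at
  proof
    show "bounded_linear ?D"
      by (intro bounded_linear_sum bounded_linear_compose[OF bounded_linear_scaleR_left bounded_linear_vec_nth])
    show "(\<lambda>h. norm (?G (x + h) - ?G x - ?D h) / norm h) \<midarrow>0\<rightarrow> 0"
    proof (rule Lim_null_comparison)
      show "\<forall>\<^sub>F h in at 0. norm (norm (?G (x + h) - ?G x - ?D h) / norm h) \<le> K * norm h"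
        proof (rule always_eventually, rule allI)
          fix h :: "real ^ 'n"
          show "norm (norm (?G (x + h) - ?G x - ?D h) / norm h) \<le> K * norm h"
            using bound[of h] by (cases "h = 0") (simp_all add: pos_divide_le_eq power2_eq_square mult.assoc)
        qed
      show "((\<lambda>h::real ^ 'n. K * norm h) \<longlongrightarrow> 0) (at 0)"
        by (auto intro!: tendsto_eq_intros)
    qed
  qed
qed

lemma partial_derivs_convolution:
  fixes g :: "real ^ 'n \<Rightarrow> complex"
  assumes w: "integrable M w" and v: "v \<in> borel_measurable M"
    and g: "smooth_on UNIV g" "\<And>\<beta>. \<exists>B. \<forall>x. norm (partial_derivs \<beta> g x) \<le> B"
  shows "partial_derivs \<beta> (\<lambda>x. \<integral>\<omega>. w \<omega> * g (x - v \<omega>) \<partial>M)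
      = (\<lambda>x. \<integral>\<omega>. w \<omega> * partial_derivs \<beta> g (x - v \<omega>) \<partial>M)"
    and smooth_on_convolution: "smooth_on UNIV (\<lambda>x. \<integral>\<omega>. w \<omega> * g (x - v \<omega>) \<partial>M)"
proof -
  have D: "((\<lambda>x. \<integral>\<omega>. w \<omega> * partial_derivs \<beta> g (x - v \<omega>) \<partial>M) has_derivative
    (\<lambda>h. \<Sum>i\<in>UNIV. (h $ i) *\<^sub>R (\<integral>\<omega>. w \<omega> * partial_derivs (i # \<beta>) g (x - v \<omega>) \<partial>M))) (at x)" for \<beta> x
    using has_derivative_convolution[OF w v smooth_on_partial_derivs[OF g(1)], of \<beta> x] g(2)
    by (simp flip: partial_derivs_append)
  show eq: "partial_derivs \<beta> (\<lambda>x. \<integral>\<omega>. w \<omega> * g (x - v \<omega>) \<partial>M)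
      = (\<lambda>x. \<integral>\<omega>. w \<omega> * partial_derivs \<beta> g (x - v \<omega>) \<partial>M)" for \<beta>
  proof (induction \<beta>)
    case (Cons i \<beta>)
    show ?case
    proof
      fix x
      have "partial_deriv i (\<lambda>x. \<integral>\<omega>. w \<omega> * partial_derivs \<beta> g (x - v \<omega>) \<partial>M) x
          = (\<Sum>j\<in>UNIV. (axis i 1 $ j) *\<^sub>R (\<integral>\<omega>. w \<omega> * partial_derivs (j # \<beta>) g (x - v \<omega>) \<partial>M))"
        by (rule partial_deriv_eqI[OF D])
      also have "\<dots> = (\<Sum>j\<in>UNIV. if j = i then \<integral>\<omega>. w \<omega> * partial_derivs (j # \<beta>) g (x - v \<omega>) \<partial>M else 0)"
        by (intro sum.cong) (auto simp: axis_def)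
      finally show "partial_derivs (i # \<beta>) (\<lambda>x. \<integral>\<omega>. w \<omega> * g (x - v \<omega>) \<partial>M) x
          = (\<integral>\<omega>. w \<omega> * partial_derivs (i # \<beta>) g (x - v \<omega>) \<partial>M)"
        by (simp add: Cons)
    qed
  qed simp
  show "smooth_on UNIV (\<lambda>x. \<integral>\<omega>. w \<omega> * g (x - v \<omega>) \<partial>M)"
    unfolding smooth_on_def eq using D by (auto simp: differentiable_def)
qed

section \<open>Smoothing symbols modulo divergences\<close>

lemma smoothing_decay:
  assumes "f \<in> smoothing"
  shows "\<exists>C. \<forall>\<xi>. (1 + norm \<xi>) ^ N * norm (partial_derivs \<beta> f \<xi>) \<le> C"
proof -
  \<comment> \<open>The order is chosen so that, after subtracting the length of
    \<open>\<beta>\<close>, the exponent is exactly -N.\<close>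
  have "f \<in> symbols (of_real (real (length \<beta>) - real N))"
    by (rule smoothing_in_symbols[OF assms])
  then have "\<exists>C. \<forall>\<xi>. norm (partial_derivs \<beta> f \<xi>)
      \<le> C * (1 + norm \<xi>) powr (Re (of_real (real (length \<beta>) - real N)) - real (length \<beta>))"
    unfolding symbols_def by blast
  then obtain C where C: "\<And>\<xi>. norm (partial_derivs \<beta> f \<xi>) \<le> C * (1 + norm \<xi>) powr (- real N)"
    by auto
  have "(1 + norm \<xi>) ^ N * norm (partial_derivs \<beta> f \<xi>) \<le> C" for \<xi>
  proof -
    have pos: "1 + norm \<xi> > 0" by (simp add: add_pos_nonneg)
    have "norm (partial_derivs \<beta> f \<xi>) \<le> C / (1 + norm \<xi>) ^ N"
      using C[of \<xi>] pos by (simp add: powr_minus_divide powr_realpow)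
    then show ?thesis using pos by (simp add: pos_le_divide_eq mult.commute)
  qed
  then show ?thesis by blast
qed

lemma smoothing_bounded:
  assumes "f \<in> smoothing"
  shows "\<exists>B. \<forall>x. norm (partial_derivs \<beta> f x) \<le> B"
  using smoothing_decay[OF assms, of 0] by simp

lemma smoothingI:
  fixes f :: "real ^ 'n \<Rightarrow> complex" and \<psi> :: "real ^ 'n \<Rightarrow> real"
  assumes "cutoff \<psi>" "smooth_on UNIV f"
    and "\<And>\<beta> N. \<exists>C. \<forall>\<xi>. (1 + norm \<xi>) ^ N * norm (partial_derivs \<beta> f \<xi>) \<le> C"
  shows "f \<in> smoothing"
proof -
  have "\<exists>C. \<forall>\<xi>. norm (partial_derivs \<beta> f \<xi>) \<le> C * (1 + norm \<xi>) powr (Re a - real (length \<beta>))" for a \<beta>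
  proof -
    \<comment> \<open>Rounded up so that decay of order N implies the required exponent. Where the
      difference is negative, \<open>nat\<close> gives 0, and boundedness is already enough.\<close>
    define N where "N = nat \<lceil>real (length \<beta>) - Re a\<rceil>"
    have N: "- real N \<le> Re a - real (length \<beta>)" unfolding N_def by linarith
    obtain C where C: "\<And>\<xi>. (1 + norm \<xi>) ^ N * norm (partial_derivs \<beta> f \<xi>) \<le> C"
      using assms(3) by blast
    have "norm (partial_derivs \<beta> f \<xi>) \<le> C * (1 + norm \<xi>) powr (Re a - real (length \<beta>))" for \<xi>
    proof -
      have pos: "1 + norm \<xi> > 0" by (simp add: add_pos_nonneg)
      have "0 \<le> (1 + norm \<xi>) ^ N * norm (partial_derivs \<beta> f \<xi>)" by simp
      then have "C \<ge> 0" using C[of \<xi>] by linarith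
      have "norm (partial_derivs \<beta> f \<xi>) \<le> C / (1 + norm \<xi>) ^ N"
        using C[of \<xi>] pos by (simp add: pos_le_divide_eq mult.commute)
      also have "\<dots> = C * (1 + norm \<xi>) powr (- real N)"
        using pos by (simp add: powr_minus_divide powr_realpow)
      also have "\<dots> \<le> C * (1 + norm \<xi>) powr (Re a - real (length \<beta>))"
        using N \<open>C \<ge> 0\<close> by (intro mult_left_mono powr_mono) auto
      finally show ?thesis .
    qed
    then show ?thesis by blast
  qed
  then have "f \<in> symbols a" for a using assms(2) by (simp add: symbols_def)
  then show ?thesis by (simp add: smoothing_eq_Inter_symbols[OF assms(1)])
qed

lemma smoothing_measurable: "f \<in> smoothing \<Longrightarrow> f \<in> borel_measurable borel"
  by (rule borel_measurable_smooth[OF smoothing_smooth])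

lemma smoothing_weighted_integrable:
  fixes f :: "real ^ 'n \<Rightarrow> complex"
  assumes "f \<in> smoothing"
  shows "integrable lborel (\<lambda>y. (1 + norm y) ^ N * norm (f y))"
proof -
  have [measurable]: "f \<in> borel_measurable borel" by (rule smoothing_measurable[OF assms])
  obtain C where C: "\<And>y. (1 + norm y) ^ (DIM(real ^ 'n) + 2 + N) * norm (f y) \<le> C"
    using smoothing_decay[OF assms, of "DIM(real ^ 'n) + 2 + N" "[]"] unfolding partial_derivs_Nil by blast
  show ?thesis
  proof (rule integrable_decay)
    show "(1 + norm y) ^ (DIM(real ^ 'n) + 2) * norm ((1 + norm y) ^ N * norm (f y)) \<le> C" for y :: "real ^ 'n"
      using C[of y] by (simp add: power_add mult.assoc abs_mult del: DIM_cart)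
  qed measurable
qed

lemma smoothing_integrable:
  fixes f :: "real ^ 'n \<Rightarrow> complex"
  assumes "f \<in> smoothing"
  shows "integrable lborel f"
  using smoothing_weighted_integrable[OF assms, of 0] smoothing_measurable[OF assms]
  by (simp add: integrable_norm_iff)

text \<open>The inequality 1 + |x| \<le> (1 + |x - v|) (1 + |v|) shares a power of the weight in x
  between g, which decays faster than any power, and the measure. The latter share is why w needs
  finite moments of every order with respect to v.\<close>

lemma smoothing_convolution:
  fixes g :: "real ^ 'n \<Rightarrow> complex" and \<psi> :: "real ^ 'n \<Rightarrow> real"
  assumes \<psi>: "cutoff \<psi>" and g: "g \<in> smoothing"
    and [measurable]: "w \<in> borel_measurable M" "v \<in> borel_measurable M"
    and int: "\<And>N. integrable M (\<lambda>\<omega>. (1 + norm (v \<omega>)) ^ N * norm (w \<omega>))"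
  shows "(\<lambda>x. \<integral>\<omega>. w \<omega> * g (x - v \<omega>) \<partial>M) \<in> smoothing"
    and "partial_deriv i (\<lambda>x. \<integral>\<omega>. w \<omega> * g (x - v \<omega>) \<partial>M)
      = (\<lambda>x. \<integral>\<omega>. w \<omega> * partial_deriv i g (x - v \<omega>) \<partial>M)"
proof -
  have w: "integrable M w" using int[of 0] by (simp add: integrable_norm_iff)
  note conv = w \<open>v \<in> borel_measurable M\<close> smoothing_smooth[OF g] smoothing_bounded[OF g]
  show "partial_deriv i (\<lambda>x. \<integral>\<omega>. w \<omega> * g (x - v \<omega>) \<partial>M)
      = (\<lambda>x. \<integral>\<omega>. w \<omega> * partial_deriv i g (x - v \<omega>) \<partial>M)"
    using partial_derivs_convolution(1)[OF conv, of "[i]"] by simp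
  show "(\<lambda>x. \<integral>\<omega>. w \<omega> * g (x - v \<omega>) \<partial>M) \<in> smoothing"
  proof (rule smoothingI[OF \<psi> smooth_on_convolution[OF conv]])
    fix \<beta> N
    obtain C where C: "\<And>\<xi>. (1 + norm \<xi>) ^ N * norm (partial_derivs \<beta> g \<xi>) \<le> C"
      using smoothing_decay[OF g] by blast
    have [measurable]: "partial_derivs \<beta> g \<in> borel_measurable borel"
      by (intro borel_measurable_smooth smooth_on_partial_derivs smoothing_smooth g)
    have "(1 + norm x) ^ N * norm (\<integral>\<omega>. w \<omega> * partial_derivs \<beta> g (x - v \<omega>) \<partial>M)
        \<le> (\<integral>\<omega>. C * ((1 + norm (v \<omega>)) ^ N * norm (w \<omega>)) \<partial>M)" for x
    proof -
      have "(1 + norm x) ^ N * norm (\<integral>\<omega>. w \<omega> * partial_derivs \<beta> g (x - v \<omega>) \<partial>M)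
          = norm (\<integral>\<omega>. (1 + norm x) ^ N *\<^sub>R (w \<omega> * partial_derivs \<beta> g (x - v \<omega>)) \<partial>M)"
        by (simp add: power_abs[symmetric] del: scaleR_complex.simps)
      also have "\<dots> \<le> (\<integral>\<omega>. C * ((1 + norm (v \<omega>)) ^ N * norm (w \<omega>)) \<partial>M)"
      proof (rule order_trans[OF integral_norm_bound Bochner_Integration.integral_mono])
        fix \<omega>
        have "(1 + norm x) ^ N \<le> (1 + norm (x - v \<omega>)) ^ N * (1 + norm (v \<omega>)) ^ N"
        proof -
          have "norm x \<le> norm (x - v \<omega>) + norm (v \<omega>)" 
            using norm_triangle_ineq[of "x - v \<omega>" "v \<omega>"] by simp
          moreover have "0 \<le> norm (x - v \<omega>) * norm (v \<omega>)" by simp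
          ultimately have "1 + norm x \<le> (1 + norm (x - v \<omega>)) * (1 + norm (v \<omega>))"
            unfolding distrib_left distrib_right by linarith
          then show ?thesis unfolding power_mult_distrib[symmetric] by (intro power_mono) auto
        qed
        then have "(1 + norm x) ^ N * norm (partial_derivs \<beta> g (x - v \<omega>))
            \<le> ((1 + norm (x - v \<omega>)) ^ N * (1 + norm (v \<omega>)) ^ N) * norm (partial_derivs \<beta> g (x - v \<omega>))"
          by (rule mult_right_mono) simp
        also have "\<dots> = (1 + norm (v \<omega>)) ^ N * ((1 + norm (x - v \<omega>)) ^ N * norm (partial_derivs \<beta> g (x - v \<omega>)))"
          by (simp only: mult_ac)
        also have "\<dots> \<le> (1 + norm (v \<omega>)) ^ N * C"
          by (intro mult_left_mono C) simp
        finally have "norm (w \<omega>) * ((1 + norm x) ^ N * norm (partial_derivs \<beta> g (x - v \<omega>)))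
            \<le> norm (w \<omega>) * ((1 + norm (v \<omega>)) ^ N * C)"
          by (rule mult_left_mono) simp
        moreover have "\<bar>1 + norm x\<bar> = 1 + norm x" by simp
        ultimately show "norm ((1 + norm x) ^ N *\<^sub>R (w \<omega> * partial_derivs \<beta> g (x - v \<omega>)))
            \<le> C * ((1 + norm (v \<omega>)) ^ N * norm (w \<omega>))"
          by (simp only: norm_scaleR norm_mult power_abs real_norm_def mult_ac)
      next
        obtain B where B: "norm (partial_derivs \<beta> g y) \<le> B" for y
          using smoothing_bounded[OF g] by blast
        have "integrable M (\<lambda>\<omega>. w \<omega> * partial_derivs \<beta> g (x - v \<omega>))"
        proof (rule Bochner_Integration.integrable_bound)
          show "integrable M (\<lambda>\<omega>. of_real B * w \<omega>)" using w by simp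
          have "norm (w \<omega> * partial_derivs \<beta> g (x - v \<omega>)) \<le> norm (of_real B * w \<omega>)" for \<omega>
            using mult_right_mono[OF B norm_ge_zero] order_trans[OF norm_ge_zero B]
            by (simp add: norm_mult mult.commute[of "norm (w \<omega>)"])
          then show "AE \<omega> in M. norm (w \<omega> * partial_derivs \<beta> g (x - v \<omega>)) \<le> norm (of_real B * w \<omega>)"
            by simp
        qed measurable
        then show "integrable M (\<lambda>\<omega>. norm ((1 + norm x) ^ N *\<^sub>R (w \<omega> * partial_derivs \<beta> g (x - v \<omega>))))"
          by (intro integrable_norm integrable_scaleR_right)
        show "integrable M (\<lambda>\<omega>. C * ((1 + norm (v \<omega>)) ^ N * norm (w \<omega>)))"
          by (intro integrable_mult_right int)
      qed
      finally show ?thesis .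
    qed
    then show "\<exists>C. \<forall>\<xi>. (1 + norm \<xi>) ^ N *
        norm (partial_derivs \<beta> (\<lambda>x. \<integral>\<omega>. w \<omega> * g (x - v \<omega>) \<partial>M) \<xi>) \<le> C"
      unfolding partial_derivs_convolution(1)[OF conv] by blast
  qed
qed

section \<open>Differences along segments as divergences\<close>

lemma FTC_segment:
  fixes r :: "real ^ 'n \<Rightarrow> complex"
  assumes "smooth_on UNIV r"
  shows "(\<integral>s. indicator {0..1} s *\<^sub>R (\<Sum>i\<in>UNIV. (y $ i) *\<^sub>R partial_deriv i r (x - s *\<^sub>R y)) \<partial>lborel)
    = r x - r (x - y)"
proof -
  have cont: "continuous_on UNIV (partial_deriv i r)" for i
    by (intro smooth_on_continuous_on smooth_on_partial_deriv assms)
  have "(\<integral>s. indicator {0..1} s *\<^sub>R (\<Sum>i\<in>UNIV. (y $ i) *\<^sub>R partial_deriv i r (x - s *\<^sub>R y)) \<partial>lborel)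
      = - r (x - 1 *\<^sub>R y) - (- r (x - 0 *\<^sub>R y))"
  proof (rule integral_FTC_Icc)
    fix s :: real
    have "((\<lambda>s. x - s *\<^sub>R y) has_derivative (\<lambda>t. - (t *\<^sub>R y))) (at s within {0..1})"
      by (auto intro!: derivative_eq_intros)
    from has_derivative_minus[OF has_derivative_compose[OF this
        has_derivative_partial_derivs[OF smooth_on_differentiable[OF assms UNIV_I]]]]
    have "((\<lambda>s. - r (x - s *\<^sub>R y)) has_derivative
        (\<lambda>t. t *\<^sub>R (\<Sum>i\<in>UNIV. (y $ i) *\<^sub>R partial_deriv i r (x - s *\<^sub>R y)))) (at s within {0..1})"
      by (simp add: scaleR_sum_right sum_negf)
    then show "((\<lambda>s. - r (x - s *\<^sub>R y)) has_vector_derivative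
        (\<Sum>i\<in>UNIV. (y $ i) *\<^sub>R partial_deriv i r (x - s *\<^sub>R y))) (at s within {0..1})"
      by (simp add: has_vector_derivative_def)
  next
    show "continuous_on {0..1} (\<lambda>s. \<Sum>i\<in>UNIV. (y $ i) *\<^sub>R partial_deriv i r (x - s *\<^sub>R y))"
      by (intro continuous_intros continuous_on_compose2[OF cont]) auto
  qed simp
  then show ?thesis by simp
qed

text \<open>Integrate \<open>\<phi>(y) (r(x - y) - r(x)) = -\<phi>(y) \<Sum>\<^sub>i y\<^sub>i \<integral>\<^sub>0\<^sup>1 \<partial>\<^sub>i r(x - s y) ds\<close> over \<open>y\<close>.\<close>

lemma convolution_minus_multiple_is_divergence:
  fixes r \<phi> :: "real ^ 'n \<Rightarrow> complex" and \<psi> :: "real ^ 'n \<Rightarrow> real"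
  assumes \<psi>: "cutoff \<psi>" and r: "r \<in> smoothing" and \<phi>: "\<phi> \<in> smoothing"
  shows "\<exists>F. (\<forall>i. F i \<in> smoothing) \<and>
    (\<forall>x. r x * (\<integral>y. \<phi> y \<partial>lborel) = (\<integral>y. \<phi> y * r (x - y) \<partial>lborel) + (\<Sum>i\<in>UNIV. partial_deriv i (F i) x))"
proof -
  let ?M = "lborel \<Otimes>\<^sub>M lborel :: ((real ^ 'n) \<times> real) measure"
  \<comment> \<open>The potentials are F_i(x) = int int_0^1 y_i phi(y) r(x - s y) ds dy. The
    indicator expresses the unit interval as a weight on the whole line, so that \<open>F\<close> is
    a superposition of translates of r over a product of Lebesgue measures.\<close>
  define w where "w = (\<lambda>i (y :: real ^ 'n, s :: real). indicator {0..1} s *\<^sub>R ((y $ i) *\<^sub>R \<phi> y))"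
  define v where "v = (\<lambda>(y :: real ^ 'n, s :: real). (indicator {0..1} s * s) *\<^sub>R y)"
  define F where "F = (\<lambda>i x. \<integral>p. w i p * r (x - v p) \<partial>?M)"
  have [measurable]: "\<phi> \<in> borel_measurable borel" "r \<in> borel_measurable borel"
    by (intro smoothing_measurable \<phi> r)+
  have [measurable]: "(\<lambda>y :: real ^ 'n. y $ i) \<in> borel_measurable borel" for i
    by (intro borel_measurable_continuous_onI continuous_intros)
  have dr: "partial_deriv i r \<in> smoothing" for i by (rule smoothing_partial_deriv[OF \<psi> r])
  have [measurable]: "partial_deriv i r \<in> borel_measurable borel" for i
    by (rule smoothing_measurable[OF dr])
  have w_meas [measurable]: "w i \<in> borel_measurable ?M" for i unfolding w_def by measurable
  have v_meas [measurable]: "v \<in> borel_measurable ?M" unfolding v_def by measurable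
  have int_w: "integrable ?M (\<lambda>p. (1 + norm (v p)) ^ N * norm (w i p))" for N i
  proof (rule Bochner_Integration.integrable_bound)
    \<comment> \<open>One power beyond N absorbs the factor y_i contained in
      \<open>w\<close>.\<close>
    show "integrable ?M (\<lambda>(y, s). indicator {0..1::real} s * ((1 + norm y) ^ (N + 1) * norm (\<phi> y)))"
    proof (rule lborel_pair.Fubini_integrable)
      show "AE y in lborel. integrable lborel (\<lambda>s. case (y, s) of (y, s) \<Rightarrow>
          indicator {0..1::real} s * ((1 + norm y) ^ (N + 1) * norm (\<phi> y)))"
        by simp
      show "integrable lborel (\<lambda>y. \<integral>s. norm (case (y, s) of (y, s) \<Rightarrow>
          indicator {0..1::real} s * ((1 + norm y) ^ (N + 1) * norm (\<phi> y))) \<partial>lborel)"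
        using smoothing_weighted_integrable[OF \<phi>, of "N + 1"] by (simp add: abs_mult power_abs)
    qed measurable
    have "(1 + norm (v (y, s))) ^ N * norm (w i (y, s))
        \<le> indicator {0..1::real} s * ((1 + norm y) ^ (N + 1) * norm (\<phi> y))" for y s
    proof (cases "s \<in> {0..1}")
      case True
      then have "(1 + norm (v (y, s))) ^ N \<le> (1 + norm y) ^ N"
        by (intro power_mono) (auto simp: v_def mult_left_le_one_le)
      moreover have "norm (w i (y, s)) \<le> (1 + norm y) * norm (\<phi> y)"
        using True component_le_norm_cart[of y i] by (auto simp: w_def norm_mult intro!: mult_right_mono)
      ultimately have "(1 + norm (v (y, s))) ^ N * norm (w i (y, s))
          \<le> (1 + norm y) ^ N * ((1 + norm y) * norm (\<phi> y))"
        by (rule mult_mono) auto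
      then show ?thesis using True by (simp add: mult_ac)
    qed (simp add: w_def)
    then show "AE p in ?M. norm ((1 + norm (v p)) ^ N * norm (w i p))
        \<le> norm (case p of (y, s) \<Rightarrow> indicator {0..1::real} s * ((1 + norm y) ^ (N + 1) * norm (\<phi> y)))"
      by (auto simp: abs_mult power_abs intro!: AE_I2)
  qed measurable
  have F: "F i \<in> smoothing" "partial_deriv i (F i) = (\<lambda>x. \<integral>p. w i p * partial_deriv i r (x - v p) \<partial>?M)" for i
    unfolding F_def
    using smoothing_convolution[OF \<psi> r w_meas v_meas int_w] by blast+
  have "r x * (\<integral>y. \<phi> y \<partial>lborel) = (\<integral>y. \<phi> y * r (x - y) \<partial>lborel) + (\<Sum>i\<in>UNIV. partial_deriv i (F i) x)" for x
  proof -
    have int_dr: "integrable ?M (\<lambda>p. w i p * partial_deriv i r (x - v p))" for i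
    proof -
      obtain B where B: "norm (partial_deriv i r y) \<le> B" for y
        using smoothing_bounded[OF dr[of i], of "[]"] by auto
      show ?thesis
      proof (rule Bochner_Integration.integrable_bound)
        show "integrable ?M (\<lambda>p. B * norm (w i p))" using int_w[of 0 i] by simp
        have "norm (w i p * partial_deriv i r (x - v p)) \<le> norm (B * norm (w i p))" for p
          using mult_right_mono[OF B norm_ge_zero] order_trans[OF norm_ge_zero B]
          by (simp add: norm_mult mult.commute[of "norm (w i p)"] abs_mult)
        then show "AE p in ?M. norm (w i p * partial_deriv i r (x - v p)) \<le> norm (B * norm (w i p))"
          by simp
      qed measurable
    qed
    have "(\<Sum>i\<in>UNIV. partial_deriv i (F i) x) = (\<integral>p. (\<Sum>i\<in>UNIV. w i p * partial_deriv i r (x - v p)) \<partial>?M)"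
      unfolding F(2) using int_dr by (simp add: integral_sum)
    \<comment> \<open>Fubini puts the integral over s inside, where it is the one evaluated by
      \<open>FTC_segment\<close>.\<close>
    also have "\<dots> = (\<integral>y. \<integral>s. (\<Sum>i\<in>UNIV. w i (y, s) * partial_deriv i r (x - v (y, s))) \<partial>lborel \<partial>lborel)"
      using int_dr by (intro lborel_pair.integral_fst'[symmetric] integrable_sum) auto
    also have "\<dots> = (\<integral>y. \<phi> y * (r x - r (x - y)) \<partial>lborel)"
    proof (rule Bochner_Integration.integral_cong[OF refl])
      fix y
      have "(\<integral>s. (\<Sum>i\<in>UNIV. w i (y, s) * partial_deriv i r (x - v (y, s))) \<partial>lborel)
          = (\<integral>s. \<phi> y * (indicator {0..1} s *\<^sub>R
              (\<Sum>i\<in>UNIV. (y $ i) *\<^sub>R partial_deriv i r (x - s *\<^sub>R y))) \<partial>lborel)"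
        by (rule Bochner_Integration.integral_cong)
          (auto simp: w_def v_def sum_distrib_left indicator_def)
      also have "\<dots> = \<phi> y * (r x - r (x - y))"
        by (simp only: integral_mult_right_zero FTC_segment[OF smoothing_smooth[OF r]])
      finally show "(\<integral>s. (\<Sum>i\<in>UNIV. w i (y, s) * partial_deriv i r (x - v (y, s))) \<partial>lborel)
        = \<phi> y * (r x - r (x - y))" .
    qed
    also have "\<dots> = r x * (\<integral>y. \<phi> y \<partial>lborel) - (\<integral>y. \<phi> y * r (x - y) \<partial>lborel)"
    proof -
      have int\<phi>: "integrable lborel \<phi>" by (rule smoothing_integrable[OF \<phi>])
      obtain B where B: "norm (r y) \<le> B" for y
        using smoothing_bounded[OF r, of "[]"] by auto
      have "integrable lborel (\<lambda>y. \<phi> y * r (x - y))"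
      proof (rule Bochner_Integration.integrable_bound)
        show "integrable lborel (\<lambda>y. B * norm (\<phi> y))" using int\<phi> by simp
        have "norm (\<phi> y * r (x - y)) \<le> norm (B * norm (\<phi> y))" for y
          using mult_right_mono[OF B norm_ge_zero] order_trans[OF norm_ge_zero B]
          by (simp add: norm_mult mult.commute[of "norm (\<phi> y)"] abs_mult)
        then show "AE y in lborel. norm (\<phi> y * r (x - y)) \<le> norm (B * norm (\<phi> y))"
          by simp
      qed measurable
      then show ?thesis using int\<phi> by (simp add: right_diff_distrib mult.commute)
    qed
    finally show ?thesis by simp
  qed
  with F(1) show ?thesis by blast
qed

lemma lborel_integral_reflect:
  fixes f :: "'a::euclidean_space \<Rightarrow> 'b::{banach, second_countable_topology}"
  assumes [measurable]: "f \<in> borel_measurable borel"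
  shows "(\<integral>y. f (x - y) \<partial>lborel) = (\<integral>y. f y \<partial>lborel)"
proof -
  have "lborel = distr lborel borel (\<lambda>y::'a. x - y)"
    using lborel_affine[of "-1" x] by (simp add: density_1)
  then have "(\<integral>y. f y \<partial>lborel) = (\<integral>y. f y \<partial>distr lborel borel (\<lambda>y::'a. x - y))"
    by simp
  also have "\<dots> = (\<integral>y. f (x - y) \<partial>lborel)"
    by (subst integral_distr) auto
  finally show ?thesis ..
qed

text \<open>The two expressions for the convolution are added crosswise, so the convolution cancels
  pointwise and no linear form has to be evaluated on it. With divergences on both sides, each side
  is a multiple of a smoothing symbol plus a divergence, the shape on which a Stokes form is easily
  computed.\<close>

lemma smoothing_proportional_mod_divergence:
  fixes r \<phi> :: "real ^ 'n \<Rightarrow> complex" and \<psi> :: "real ^ 'n \<Rightarrow> real"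
  assumes \<psi>: "cutoff \<psi>" and r: "r \<in> smoothing" and \<phi>: "\<phi> \<in> smoothing"
  shows "\<exists>F G. (\<forall>i. F i \<in> smoothing \<and> G i \<in> smoothing) \<and>
    (\<forall>x. (\<integral>y. \<phi> y \<partial>lborel) * r x + (\<Sum>i\<in>UNIV. partial_deriv i (F i) x)
      = (\<integral>y. r y \<partial>lborel) * \<phi> x + (\<Sum>i\<in>UNIV. partial_deriv i (G i) x))"
proof -
  note [measurable] = smoothing_measurable[OF \<phi>] smoothing_measurable[OF r]
  have sym: "(\<integral>y. \<phi> y * r (x - y) \<partial>lborel) = (\<integral>y. r y * \<phi> (x - y) \<partial>lborel)" for x
    using lborel_integral_reflect[of "\<lambda>y. r y * \<phi> (x - y)" x] by (simp add: mult.commute)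
  obtain G where G: "\<And>i. G i \<in> smoothing"
    "\<And>x. r x * (\<integral>y. \<phi> y \<partial>lborel) = (\<integral>y. \<phi> y * r (x - y) \<partial>lborel) + (\<Sum>i\<in>UNIV. partial_deriv i (G i) x)"
    using convolution_minus_multiple_is_divergence[OF \<psi> r \<phi>] by blast
  obtain F where F: "\<And>i. F i \<in> smoothing"
    "\<And>x. \<phi> x * (\<integral>y. r y \<partial>lborel) = (\<integral>y. r y * \<phi> (x - y) \<partial>lborel) + (\<Sum>i\<in>UNIV. partial_deriv i (F i) x)"
    using convolution_minus_multiple_is_divergence[OF \<psi> \<phi> r] by blast
  show ?thesis
    using F G by (intro exI[of _ F] exI[of _ G]) (simp add: mult.commute[of "integral\<^sup>L _ _"] sym)
qed

text \<open>\<open>1 - \<psi>\<close> is 1 near the origin and vanishes outside the unit ball. A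
  cut-off may take any real values in between, so the square is used: it is nonnegative, still 1
  near the origin, and hence has positive integral.\<close>

lemma ex_smoothing_integral_nonzero:
  fixes \<psi> :: "real ^ 'n \<Rightarrow> real"
  assumes \<psi>: "cutoff \<psi>"
  shows "\<exists>\<phi> :: real ^ 'n \<Rightarrow> complex. \<phi> \<in> smoothing \<and> (\<integral>y. \<phi> y \<partial>lborel) \<noteq> 0"
proof -
  define \<phi> where "\<phi> = (\<lambda>x. complex_of_real ((1 - \<psi> x) * (1 - \<psi> x)))"
  obtain \<epsilon> where \<epsilon>: "\<epsilon> > 0" "\<And>\<xi>. norm \<xi> < \<epsilon> \<Longrightarrow> \<psi> \<xi> = 0"
    using \<psi> by (auto simp: cutoff_def)
  have out: "\<psi> \<xi> = 1" if "norm \<xi> \<ge> 1" for \<xi> using \<psi> that by (auto simp: cutoff_def)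
  have "smooth_on UNIV (\<lambda>x. 1 - \<psi> x)"
    using \<psi> by (intro smooth_on_diff smooth_on_const) (simp add: cutoff_def)
  then have smooth: "smooth_on UNIV \<phi>"
    unfolding \<phi>_def
    by (intro smooth_on_bounded_linear[OF bounded_linear_of_real]
        smooth_on_bounded_bilinear[OF bounded_bilinear_mult])
  have "\<phi> \<in> smoothing"
  proof (rule smoothingI[OF \<psi> smooth])
    fix \<beta> N
    have zero: "partial_derivs \<beta> \<phi> \<xi> = 0" if "norm \<xi> > 1" for \<xi>
    proof (rule partial_derivs_eq_0_open)
      show "open (- cball (0 :: real ^ 'n) 1)" by (simp add: open_Compl)
      show "\<xi> \<in> - cball 0 1" using that by simp
      show "\<phi> y = 0" if "y \<in> - cball 0 1" for y using that out[of y] by (simp add: \<phi>_def)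
    qed
    have "compact ((\<lambda>\<xi>. (1 + norm \<xi>) ^ N * norm (partial_derivs \<beta> \<phi> \<xi>)) ` cball 0 1)"
      by (intro compact_continuous_image continuous_intros
          continuous_on_subset[OF smooth_on_continuous_on[OF smooth_on_partial_derivs[OF smooth]]]) auto
    then obtain C where C: "\<And>\<xi>. norm \<xi> \<le> 1 \<Longrightarrow> (1 + norm \<xi>) ^ N * norm (partial_derivs \<beta> \<phi> \<xi>) \<le> C"
      by (force dest!: compact_imp_bounded simp: bounded_iff)
    have "(1 + norm \<xi>) ^ N * norm (partial_derivs \<beta> \<phi> \<xi>) \<le> max C 0" for \<xi>
      using C[of \<xi>] zero[of \<xi>] by (cases "norm \<xi> \<le> 1") auto
    then show "\<exists>C. \<forall>\<xi>. (1 + norm \<xi>) ^ N * norm (partial_derivs \<beta> \<phi> \<xi>) \<le> C" by blast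
  qed
  moreover have "(\<integral>y. \<phi> y \<partial>lborel) \<noteq> 0"
  proof -
    let ?f = "\<lambda>x. (1 - \<psi> x) * (1 - \<psi> x)"
    have int: "integrable lborel ?f"
      using smoothing_integrable[OF \<open>\<phi> \<in> smoothing\<close>] by (simp only: \<phi>_def complex_of_real_integrable_eq)
    have "0 < measure lborel (ball (0 :: real ^ 'n) \<epsilon>)"
      using \<epsilon>(1) by simp
    also have "\<dots> = (\<integral>x. indicator (ball (0 :: real ^ 'n) \<epsilon>) x \<partial>lborel)" by simp
    also have "\<dots> \<le> (\<integral>x. ?f x \<partial>lborel)"
    proof (rule integral_mono[OF _ int])
      show "integrable lborel (indicator (ball (0 :: real ^ 'n) \<epsilon>) :: _ \<Rightarrow> real)"
        by (rule integrable_real_indicator) (simp, rule emeasure_lborel_ball_finite)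
      show "indicator (ball 0 \<epsilon>) x \<le> ?f x" for x
        using \<epsilon>(2)[of x] by (auto simp: indicator_def)
    qed
    finally show ?thesis by (simp only: \<phi>_def integral_complex_of_real of_real_eq_0_iff)
  qed
  ultimately show ?thesis by blast
qed

section \<open>Constant terms of expansions at infinity\<close>

text \<open>For t = exp(1 / |e|) the power is exp(z) with z = e / |e| of modulus 1, while exp(z) = 1
  only for integer multiples of 2 pi i, whose modulus is 0 or at least 2 pi.\<close>

lemma ex_powr_neq_1:
  assumes "e \<noteq> (0 :: complex)"
  shows "\<exists>t > 1. of_real t powr e \<noteq> 1"
proof (intro exI conjI)
  show "exp (1 / norm e) > 1" using assms by simp
  have "of_real (exp (1 / norm e)) powr e = exp (e / of_real (norm e))"
    by (simp add: powr_def Ln_of_real)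
  moreover have "exp (e / of_real (norm e)) \<noteq> 1"
  proof
    assume "exp (e / of_real (norm e)) = 1"
    moreover define z where "z = e / of_real (norm e)"
    ultimately obtain n :: int where n: "Re z = 0" "Im z = of_int (2 * n) * pi"
      unfolding exp_eq_1 by blast
    have "norm z = 1" using assms by (simp add: z_def norm_divide)
    then have abs: "\<bar>of_int (2 * n) * pi\<bar> = 1"
      using n by (simp add: cmod_def)
    show False
    proof (cases "n = 0")
      case False
      then have "(1::real) \<le> \<bar>of_int n\<bar>" by linarith
      then have "2 * pi \<le> \<bar>of_int (2 * n) * pi\<bar>" by (simp add: abs_mult)
      with abs pi_gt3 show False by linarith
    qed (use abs in simp)
  qed
  ultimately show "of_real (exp (1 / norm e)) powr e \<noteq> 1" by simp
qed

text \<open>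
  The combination \<open>F (t R) - t\<^sup>e F R\<close> removes the exponent \<open>e\<close> and multiplies the other unknowns
  by \<open>1 - t\<^sup>e\<close>, up to a multiple of the coefficient of the logarithm in the constant.
\<close>

lemma powr_log_expansion_unique:
  assumes "finite E" "0 \<notin> E"
    and "((\<lambda>R. (\<Sum>e\<in>E. C e * complex_of_real R powr e) + b * complex_of_real (ln R) + c) \<longlongrightarrow> 0) at_top"
  shows "b = 0 \<and> c = 0"
  using assms
proof (induction E arbitrary: C b c)
  case empty
  have lim: "((\<lambda>R. b * complex_of_real (ln R) + c) \<longlongrightarrow> 0) at_top"
    using empty by simp
  \<comment> \<open>Comparing the values at 2 R and R cancels the constant and leaves b ln 2, which
    must therefore be 0.\<close>
  have "filterlim (\<lambda>R::real. 2 * R) at_top at_top"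
    by (rule filterlim_tendsto_pos_mult_at_top[OF tendsto_const]) (auto simp: filterlim_ident)
  from filterlim_compose[OF lim this]
  have "((\<lambda>R. (b * complex_of_real (ln (2 * R)) + c) - (b * complex_of_real (ln R) + c)) \<longlongrightarrow> 0 - 0) at_top"
    by (rule tendsto_diff[OF _ lim])
  moreover have "\<forall>\<^sub>F R::real in at_top.
      (b * complex_of_real (ln (2 * R)) + c) - (b * complex_of_real (ln R) + c) = b * complex_of_real (ln 2)"
    using eventually_gt_at_top[of 0] by eventually_elim (simp add: ln_mult algebra_simps)
  ultimately have "((\<lambda>R::real. b * complex_of_real (ln 2)) \<longlongrightarrow> 0) at_top"
    by (simp add: filterlim_cong)
  then have "b = 0" by (simp add: tendsto_const_iff)
  with lim show ?case by (simp add: tendsto_const_iff)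
next
  case (insert e E)
  obtain t :: real where t: "t > 1" "of_real t powr e \<noteq> 1"
    using ex_powr_neq_1[of e] insert.prems(1) by auto
  let ?F = "\<lambda>R. (\<Sum>e\<in>insert e E. C e * complex_of_real R powr e) + b * complex_of_real (ln R) + c"
  let ?G = "\<lambda>R. (\<Sum>e'\<in>E. (C e' * (of_real t powr e' - of_real t powr e)) * complex_of_real R powr e')
      + (b * (1 - of_real t powr e)) * complex_of_real (ln R)
      + (b * complex_of_real (ln t) + c * (1 - of_real t powr e))"
  have "filterlim (\<lambda>R. t * R) at_top at_top"
    using t by (intro filterlim_tendsto_pos_mult_at_top[OF tendsto_const]) (auto simp: filterlim_ident)
  from filterlim_compose[OF insert.prems(2) this]
  have "((\<lambda>R. ?F (t * R) - of_real t powr e * ?F R) \<longlongrightarrow> 0 - of_real t powr e * 0) at_top"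
    by (intro tendsto_diff tendsto_mult_left insert.prems(2))
  moreover have "\<forall>\<^sub>F R::real in at_top. ?F (t * R) - of_real t powr e * ?F R = ?G R"
    using eventually_gt_at_top[of 0]
  proof eventually_elim
    fix R :: real assume R: "R > 0"
    have pw: "complex_of_real (t * R) powr e' = of_real t powr e' * of_real R powr e'" for e'
      using R t by (simp add: powr_times_real)
    have ln: "complex_of_real (ln (t * R)) = of_real (ln t) + of_real (ln R)"
      using R t by (simp add: ln_mult)
    have "(\<Sum>e'\<in>E. C e' * complex_of_real (t * R) powr e') - of_real t powr e * (\<Sum>e'\<in>E. C e' * of_real R powr e')
        = (\<Sum>e'\<in>E. (C e' * (of_real t powr e' - of_real t powr e)) * complex_of_real R powr e')"
      unfolding pw sum_distrib_left sum_subtractf[symmetric]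
      by (intro sum.cong refl) (simp add: algebra_simps)
    moreover have "C e * complex_of_real (t * R) powr e - of_real t powr e * (C e * of_real R powr e) = 0"
      unfolding pw by simp
    ultimately show "?F (t * R) - of_real t powr e * ?F R = ?G R"
      using insert.hyps unfolding ln sum.insert[OF insert.hyps] by (simp add: algebra_simps)
  qed
  ultimately have "(?G \<longlongrightarrow> 0) at_top"
    by (simp add: filterlim_cong)
  from insert.IH[OF _ this] insert.prems(1)
  have "b * (1 - of_real t powr e) = 0 \<and> b * complex_of_real (ln t) + c * (1 - of_real t powr e) = 0"
    by simp
  with t show ?case by auto
qed

section \<open>Calculus of constant terms\<close>

lemma is_constant_term_add:
  assumes "is_constant_term F c" "is_constant_term G d"
  shows "is_constant_term (\<lambda>R. F R + G R) (c + d)"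
proof -
  obtain E C b where E: "finite E" "0 \<notin> E"
    "((\<lambda>R. F R - (\<Sum>e\<in>E. C e * complex_of_real R powr e) - b * complex_of_real (ln R)) \<longlongrightarrow> c) at_top"
    using assms(1) unfolding is_constant_term_def by blast
  obtain E' C' b' where E': "finite E'" "0 \<notin> E'"
    "((\<lambda>R. G R - (\<Sum>e\<in>E'. C' e * complex_of_real R powr e) - b' * complex_of_real (ln R)) \<longlongrightarrow> d) at_top"
    using assms(2) unfolding is_constant_term_def by blast
  \<comment> \<open>The two exponent sets may overlap; coefficients are extended by zero to the
    union and added there.\<close>
  define D where "D e = (if e \<in> E then C e else 0) + (if e \<in> E' then C' e else 0)" for e
  have D: "(\<Sum>e\<in>E \<union> E'. D e * complex_of_real R powr e)
      = (\<Sum>e\<in>E. C e * complex_of_real R powr e) + (\<Sum>e\<in>E'. C' e * complex_of_real R powr e)" for R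
  proof -
    have "(\<Sum>e\<in>E \<union> E'. (if e \<in> E then C e else 0) * complex_of_real R powr e)
        = (\<Sum>e\<in>E. C e * complex_of_real R powr e)"
      using E E' by (intro sum.mono_neutral_cong_right) auto
    moreover have "(\<Sum>e\<in>E \<union> E'. (if e \<in> E' then C' e else 0) * complex_of_real R powr e)
        = (\<Sum>e\<in>E'. C' e * complex_of_real R powr e)"
      using E E' by (intro sum.mono_neutral_cong_right) auto
    ultimately show ?thesis by (simp only: D_def distrib_right sum.distrib)
  qed
  have "((\<lambda>R. F R + G R - (\<Sum>e\<in>E \<union> E'. D e * complex_of_real R powr e) - (b + b') * complex_of_real (ln R))
      \<longlongrightarrow> c + d) at_top"
    using tendsto_add[OF E(3) E'(3)] unfolding D by (simp add: algebra_simps)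
  with E E' show ?thesis unfolding is_constant_term_def
    by - (rule exI[of _ "E \<union> E'"], rule exI[of _ D], rule exI[of _ "b + b'"], simp)
qed

lemma is_constant_term_scale:
  assumes "is_constant_term F c"
  shows "is_constant_term (\<lambda>R. k * F R) (k * c)"
proof -
  obtain E C b where E: "finite E" "0 \<notin> E"
    "((\<lambda>R. F R - (\<Sum>e\<in>E. C e * complex_of_real R powr e) - b * complex_of_real (ln R)) \<longlongrightarrow> c) at_top"
    using assms(1) unfolding is_constant_term_def by blast
  have "((\<lambda>R. k * F R - (\<Sum>e\<in>E. (k * C e) * complex_of_real R powr e) - (k * b) * complex_of_real (ln R))
      \<longlongrightarrow> k * c) at_top"
    using tendsto_mult_left[OF E(3), of k] by (simp add: right_diff_distrib sum_distrib_left mult.assoc)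
  with E show ?thesis unfolding is_constant_term_def
    by - (rule exI[of _ E], rule exI[of _ "\<lambda>e. k * C e"], rule exI[of _ "k * b"], simp)
qed

lemma is_constant_term_tendsto: "(F \<longlongrightarrow> c) at_top \<Longrightarrow> is_constant_term F c"
  unfolding is_constant_term_def 
  by (rule exI[of _ "{}"], rule exI[of _ "\<lambda>_. 0"], rule exI[of _ 0]) simp

lemma is_constant_term_powr: "e \<noteq> 0 \<Longrightarrow> is_constant_term (\<lambda>R. complex_of_real R powr e) 0"
  unfolding is_constant_term_def 
  by (rule exI[of _ "{e}"], rule exI[of _ "\<lambda>_. 1"], rule exI[of _ 0]) simp

lemma is_constant_term_ln: "is_constant_term (\<lambda>R. complex_of_real (ln R)) 0"
  unfolding is_constant_term_def 
  by (rule exI[of _ "{}"], rule exI[of _ "\<lambda>_. 0"], rule exI[of _ 1]) simp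

lemma is_constant_term_cong:
  assumes "\<forall>\<^sub>F R in at_top. F R = G R" "is_constant_term F c"
  shows "is_constant_term G c"
proof -
  obtain E C b where E: "finite E" "0 \<notin> E"
    "((\<lambda>R. F R - (\<Sum>e\<in>E. C e * complex_of_real R powr e) - b * complex_of_real (ln R)) \<longlongrightarrow> c) at_top"
    using assms(2) unfolding is_constant_term_def by blast
  have "((\<lambda>R. G R - (\<Sum>e\<in>E. C e * complex_of_real R powr e) - b * complex_of_real (ln R)) \<longlongrightarrow> c) at_top"
    by (rule Lim_transform_eventually[OF E(3)]) (use assms(1) in eventually_elim, simp)
  with E show ?thesis unfolding is_constant_term_def by blast
qed

lemma ex_constant_term_sum:
  assumes "\<And>a. a \<in> A \<Longrightarrow> \<exists>c. is_constant_term (F a) c"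
  shows "\<exists>c. is_constant_term (\<lambda>R. \<Sum>a\<in>A. F a R) c"
  using assms
proof (induction A rule: infinite_finite_induct)
  case (insert a A)
  then obtain c d where "is_constant_term (F a) c" "is_constant_term (\<lambda>R. \<Sum>a\<in>A. F a R) d"
    by blast
  from is_constant_term_add[OF this] show ?case using insert.hyps by auto
qed (auto intro: is_constant_term_tendsto tendsto_const)

text \<open>Two expansions of one function may use different exponents. Their difference expands the
  zero function over the union of the exponents, with constant term c - d, so that
  \<open>powr_log_expansion_unique\<close> applies.\<close>

lemma is_constant_term_unique:
  assumes "is_constant_term F c" "is_constant_term F d"
  shows "c = d"
proof -
  have "is_constant_term (\<lambda>R. F R + - 1 * F R) (c + - 1 * d)"
    by (intro is_constant_term_add is_constant_term_scale assms)
  then obtain E C b where E: "finite E" "0 \<notin> E"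
    "((\<lambda>R. 0 - (\<Sum>e\<in>E. C e * complex_of_real R powr e) - b * complex_of_real (ln R)) \<longlongrightarrow> c - d) at_top"
    unfolding is_constant_term_def by auto
  have "((\<lambda>R. (\<Sum>e\<in>E. C e * complex_of_real R powr e) + b * complex_of_real (ln R) + (c - d)) \<longlongrightarrow> 0) at_top"
    using tendsto_diff[OF tendsto_const[of "c - d"] E(3)] by (simp add: algebra_simps)
  from powr_log_expansion_unique[OF E(1,2) this] show ?thesis by simp
qed

lemma cutoff_integral_eq:
  "is_constant_term (\<lambda>R. LINT \<xi>:ball 0 R|lborel. \<sigma> \<xi>) c \<Longrightarrow> cutoff_integral \<sigma> = c"
  unfolding cutoff_integral_def by (rule the_equality) (auto intro: is_constant_term_unique)

section \<open>Integrals of homogeneous functions over annuli\<close>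

text \<open>Half-open: the inner sphere is included and the outer one is not. Consecutive annuli, or
  a ball and the annulus around it, are then disjoint with union exactly an annulus or a ball, and
  no null sets need to be discarded.\<close>

definition annulus :: "real \<Rightarrow> real \<Rightarrow> (real ^ 'n) set"
  where "annulus r R = ball 0 R - ball 0 r"

lemma annulus_measurable [measurable]: "annulus r R \<in> sets borel"
  by (simp add: annulus_def)

lemma set_integrable_annulus:
  fixes f :: "real ^ 'n \<Rightarrow> complex"
  assumes "continuous_on (- {0}) f" "r > 0"
  shows "set_integrable lborel (annulus r R) f"
proof -
  have "compact (cball 0 R - ball 0 r :: (real ^ 'n) set)"
    by (intro compact_diff) auto
  moreover have "continuous_on (cball 0 R - ball 0 r) f"
    by (rule continuous_on_subset[OF assms(1)]) (use assms(2) in auto)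
  ultimately have "set_integrable lborel (cball 0 R - ball 0 r) f"
    unfolding set_integrable_def by (rule borel_integrable_compact)
  then show ?thesis
    by (rule set_integrable_subset) (auto simp: annulus_def)
qed

lemma set_integral_annulus_split:
  fixes f :: "real ^ 'n \<Rightarrow> complex"
  assumes "continuous_on (- {0}) f" "0 < r" "r \<le> s" "s \<le> R"
  shows "(LINT x:annulus r R|lborel. f x) = (LINT x:annulus r s|lborel. f x) + (LINT x:annulus s R|lborel. f x)"
proof -
  have "annulus r R = (annulus r s \<union> annulus s R :: (real ^ 'n) set)" "annulus r s \<inter> annulus s R = ({} :: (real ^ 'n) set)"
    using assms by (auto simp: annulus_def)
  then show ?thesis
    using assms by (simp add: set_integral_Un set_integrable_annulus)
qed

lemma lborel_integral_scale:
  fixes h :: "'a::euclidean_space \<Rightarrow> 'b::{banach, second_countable_topology}"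
  assumes [measurable]: "h \<in> borel_measurable borel" and c: "c > 0"
  shows "(\<integral>x. h x \<partial>lborel) = c ^ DIM('a) *\<^sub>R (\<integral>x. h (c *\<^sub>R x) \<partial>lborel)"
proof -
  have "(\<integral>x. h x \<partial>lborel) = (\<integral>x. h x \<partial>density (distr lborel borel (\<lambda>x. 0 + c *\<^sub>R x)) (\<lambda>_. \<bar>c\<bar> ^ DIM('a)))"
    using lborel_affine[of c "0::'a"] c by simp
  also have "\<dots> = (\<integral>x. (\<bar>c\<bar> ^ DIM('a)) *\<^sub>R h x \<partial>distr lborel borel (\<lambda>x. 0 + c *\<^sub>R x))"
    by (rule integral_density) auto
  also have "\<dots> = (\<integral>x. (\<bar>c\<bar> ^ DIM('a)) *\<^sub>R h (0 + c *\<^sub>R x) \<partial>lborel)"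
    by (rule integral_distr) auto
  finally show ?thesis using c by simp
qed

text \<open>The substitution R x contributes R^b by homogeneity and R^n by the Jacobian.\<close>

lemma set_integral_annulus_scale:
  fixes f :: "real ^ 'n \<Rightarrow> complex"
  assumes f: "continuous_on (- {0}) f" "pos_homogeneous b f" and "R > 0"
  shows "(LINT x:annulus R (R * S)|lborel. f x)
    = of_real R powr (b + of_nat CARD('n)) * (LINT x:annulus 1 S|lborel. f x)"
proof -
  have meas: "(\<lambda>x. indicator (annulus R (R * S)) x *\<^sub>R f x) \<in> borel_measurable borel"
    using set_integrable_annulus[OF f(1) \<open>R > 0\<close>, of "R * S"]
    unfolding set_integrable_def by (auto dest: borel_measurable_integrable)
  have "(LINT x:annulus R (R * S)|lborel. f x)
      = R ^ CARD('n) *\<^sub>R (\<integral>x. indicator (annulus R (R * S)) (R *\<^sub>R x) *\<^sub>R f (R *\<^sub>R x) \<partial>lborel)"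
    unfolding set_lebesgue_integral_def using lborel_integral_scale[OF meas \<open>R > 0\<close>] by simp
  also have "(\<lambda>x. indicator (annulus R (R * S)) (R *\<^sub>R x) *\<^sub>R f (R *\<^sub>R x))
      = (\<lambda>x. of_real R powr b * (indicator (annulus 1 S) x *\<^sub>R f x))"
  proof
    fix x :: "real ^ 'n"
    have "R *\<^sub>R x \<in> annulus R (R * S) \<longleftrightarrow> x \<in> annulus 1 S"
      using \<open>R > 0\<close> by (simp add: annulus_def)
    moreover have "f (R *\<^sub>R x) = of_real R powr b * f x" if "x \<in> annulus 1 S"
    proof -
      have "x \<noteq> 0" using that by (auto simp: annulus_def)
      then show ?thesis using f(2) \<open>R > 0\<close> by (simp add: pos_homogeneous_def)
    qed
    ultimately show "indicator (annulus R (R * S)) (R *\<^sub>R x) *\<^sub>R f (R *\<^sub>R x)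
        = of_real R powr b * (indicator (annulus 1 S) x *\<^sub>R f x)"
      by (cases "x \<in> annulus 1 S") auto
  qed
  also have "R ^ CARD('n) *\<^sub>R (\<integral>x. of_real R powr b * (indicator (annulus 1 S) x *\<^sub>R f x) \<partial>lborel)
      = (of_real R powr b * of_real R ^ CARD('n)) * (LINT x:annulus 1 S|lborel. f x)"
    unfolding set_lebesgue_integral_def by (simp add: scaleR_conv_of_real)
  also have "of_real R powr b * of_real R ^ CARD('n) = complex_of_real R powr (b + of_nat CARD('n))"
    using \<open>R > 0\<close> by (simp add: powr_add)
  finally show ?thesis .
qed

text \<open>Additivity and \<open>D 1 = 0\<close> make D vanish at the natural numbers, so
  subtracting the integer part extends the bound M from the unit interval to the half-line. But D(n
  t) = n D(t) would be unbounded unless D(t) = 0. It solves Cauchy's functional equation with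
  boundedness in place of continuity.\<close>

lemma additive_bounded_eq_0:
  fixes D :: "real \<Rightarrow> 'a::real_normed_vector"
  assumes add: "\<And>s t. 0 \<le> s \<Longrightarrow> 0 \<le> t \<Longrightarrow> D (s + t) = D s + D t"
    and one: "D 1 = 0" and M: "\<And>t. 0 \<le> t \<Longrightarrow> t \<le> 1 \<Longrightarrow> norm (D t) \<le> M" and "t \<ge> 0"
  shows "D t = 0"
proof -
  have mult: "D (real n * t) = real n *\<^sub>R D t" if "t \<ge> 0" for n t
  proof (induction n)
    case 0
    then show ?case using add[of 0 0] by simp
  next
    case (Suc n)
    have "D (real (Suc n) * t) = D (t + real n * t)" by (simp add: distrib_right)
    also have "\<dots> = D t + D (real n * t)" using that by (intro add) auto
    finally show ?case using Suc by (simp add: scaleR_add_left)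
  qed
  have bound: "norm (D s) \<le> M" if "s \<ge> 0" for s
  proof -
    define n where "n = nat \<lfloor>s\<rfloor>"
    have n: "real n \<le> s" "s - real n \<le> 1" unfolding n_def using that by (simp_all, linarith)
    have "D s = D (real n * 1) + D (s - real n)"
      using add[of "real n" "s - real n"] n by simp
    then show ?thesis using M[of "s - real n"] mult[of 1 n] n one by simp
  qed
  have "real n * norm (D t) \<le> M" for n
    using bound[of "real n * t"] \<open>t \<ge> 0\<close> by (simp add: mult)
  then have "\<not> norm (D t) > 0"
    using reals_Archimedean3[of "norm (D t)"] by (meson not_le)
  then show ?thesis by simp
qed

text \<open>The functional equation alone determines F, without polar coordinates. If e = b + n is
  nonzero, exchanging R and S gives F(R) (1 - S^e) = F(S) (1 - R^e), so F is a multiple of 1 - R^e.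
  If e = 0, t \<mapsto> F(exp t) is additive and bounded on the unit interval, so F(R) = F(exp 1) ln
  R with constant term 0. This is the source of the logarithm.\<close>

lemma ex_constant_term_homogeneous:
  fixes f :: "real ^ 'n \<Rightarrow> complex"
  assumes f: "continuous_on (- {0}) f" "pos_homogeneous b f"
  shows "\<exists>c. is_constant_term (\<lambda>R. LINT x:annulus 1 R|lborel. f x) c"
proof -
  define F where "F R = (LINT x:annulus 1 R|lborel. f x)" for R
  define e where "e = b + of_nat CARD('n)"
  have mult: "F (R * S) = F R + of_real R powr e * F S" if "R \<ge> 1" "S \<ge> 1" for R S
    unfolding F_def e_def using set_integral_annulus_split[OF f(1), of 1 R "R * S"]
      set_integral_annulus_scale[OF f, of R S] that by simp
  have "\<exists>c. is_constant_term F c"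
  proof (cases "e = 0")
    case False
    then obtain S where S: "S > 1" "of_real S powr e \<noteq> 1" using ex_powr_neq_1 by blast
    define k where "k = F S / (1 - of_real S powr e)"
    have F: "F R = k + (- k) * of_real R powr e" if "R \<ge> 1" for R
    proof -
      have "F R + of_real R powr e * F S = F S + of_real S powr e * F R"
        using mult[of R S] mult[of S R] that S by (simp add: mult.commute)
      then have "F R * (1 - of_real S powr e) = F S * (1 - of_real R powr e)"
        by (simp add: algebra_simps)
      then have "F R = k * (1 - of_real R powr e)"
        using S by (simp add: k_def divide_simps)
      then show ?thesis by (simp add: algebra_simps)
    qed
    have ct: "is_constant_term (\<lambda>R. k + (- k) * of_real R powr e) (k + (- k) * 0)"
      using False by (intro is_constant_term_add is_constant_term_scale is_constant_term_powr
          is_constant_term_tendsto tendsto_const)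
    have "\<forall>\<^sub>F R in at_top. k + (- k) * of_real R powr e = F R"
      using eventually_ge_at_top[of 1] by eventually_elim (rule F[symmetric])
    then show ?thesis by (intro exI) (rule is_constant_term_cong[OF _ ct])
  next
    case True
    have F: "F (exp t) - of_real t * F (exp 1) = 0" if "t \<ge> 0" for t
    proof (rule additive_bounded_eq_0[OF _ _ _ that])
      show "F (exp (s + t)) - of_real (s + t) * F (exp 1)
          = (F (exp s) - of_real s * F (exp 1)) + (F (exp t) - of_real t * F (exp 1))"
        if "0 \<le> s" "0 \<le> t" for s t
        using that mult[of "exp s" "exp t"] True by (simp add: exp_add powr_0 algebra_simps)
      \<comment> \<open>For t at most 1 the annulus lies in the one of outer radius exp 1, so the
        integral of the norm over the latter bounds F uniformly.\<close>
      show "norm (F (exp t) - of_real t * F (exp 1))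
          \<le> (LINT x:annulus 1 (exp 1)|lborel. norm (f x)) + norm (F (exp 1))" if "0 \<le> t" "t \<le> 1" for t
      proof -
        have "norm (F (exp t)) \<le> (LINT x:annulus 1 (exp 1)|lborel. norm (f x))"
          unfolding F_def set_lebesgue_integral_def
        proof (rule order_trans[OF integral_norm_bound Bochner_Integration.integral_mono])
          show "integrable lborel (\<lambda>x. norm (indicator (annulus 1 (exp t)) x *\<^sub>R f x))"
            using set_integrable_annulus[OF f(1), of 1 "exp t"]
            unfolding set_integrable_def by (intro integrable_norm) simp
          show "integrable lborel (\<lambda>x. indicator (annulus 1 (exp 1)) x *\<^sub>R norm (f x))"
            using set_integrable_norm[OF set_integrable_annulus[OF f(1), of 1 "exp 1"]]
            unfolding set_integrable_def by simp
          show "norm (indicator (annulus 1 (exp t)) x *\<^sub>R f x) \<le> indicator (annulus 1 (exp 1)) x *\<^sub>R norm (f x)"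
            for x
          proof -
            have "exp t \<le> exp (1::real)" using that by simp
            then have "annulus 1 (exp t) \<subseteq> annulus 1 (exp 1 :: real)"
              unfolding annulus_def by (intro Diff_mono subset_ball) auto
            then show ?thesis by (auto simp: indicator_def)
          qed
        qed
        moreover have "norm (of_real t * F (exp 1)) \<le> norm (F (exp 1))"
          using that by (simp add: norm_mult mult_left_le_one_le)
        ultimately show ?thesis by (rule order_trans[OF norm_triangle_ineq4 add_mono])
      qed
    qed simp
    have ct: "is_constant_term (\<lambda>R. F (exp 1) * of_real (ln R)) (F (exp 1) * 0)"
      by (intro is_constant_term_scale is_constant_term_ln)
    have "\<forall>\<^sub>F R in at_top. F (exp 1) * of_real (ln R) = F R"
      using eventually_ge_at_top[of 1]
    proof eventually_elim
      fix R :: real assume "R \<ge> 1"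
      then show "F (exp 1) * of_real (ln R) = F R" using F[of "ln R"] by (simp add: mult.commute)
    qed
    then show ?thesis by (intro exI) (rule is_constant_term_cong[OF _ ct])
  qed
  then show ?thesis by (simp add: F_def[abs_def])
qed

lemma pos_homogeneous_partial_deriv:
  fixes h :: "real ^ 'n \<Rightarrow> complex"
  assumes "smooth_on (- {0}) h" "pos_homogeneous b h"
  shows "pos_homogeneous (b - 1) (partial_deriv i h)"
  unfolding pos_homogeneous_def
proof (intro allI impI)
  fix t :: real and \<xi> :: "real ^ 'n" assume t: "t > 0" and \<xi>: "\<xi> \<noteq> 0"
  have diff: "h differentiable (at x)" if "x \<noteq> 0" for x
    using smooth_on_differentiable[OF assms(1)] that by simp
  have "(h has_derivative frechet_derivative h (at (t *\<^sub>R \<xi>))) (at (t *\<^sub>R \<xi>))"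
    using diff[of "t *\<^sub>R \<xi>"] t \<xi> by (simp add: frechet_derivative_works)
  from has_derivative_compose[OF has_derivative_scaleR_right[OF has_derivative_ident] this]
  have D: "((\<lambda>x. h (t *\<^sub>R x)) has_derivative (\<lambda>x. frechet_derivative h (at (t *\<^sub>R \<xi>)) (t *\<^sub>R x))) (at \<xi>)" .
  have lin: "linear (frechet_derivative h (at (t *\<^sub>R \<xi>)))"
    using diff[of "t *\<^sub>R \<xi>"] t \<xi> by (intro linear_frechet_derivative) simp
  have "t *\<^sub>R partial_deriv i h (t *\<^sub>R \<xi>) = partial_deriv i (\<lambda>x. h (t *\<^sub>R x)) \<xi>"
    unfolding partial_deriv_eqI[OF D] using lin by (simp add: partial_deriv_def linear_scale)
  also have "\<dots> = partial_deriv i (\<lambda>x. of_real t powr b * h x) \<xi>"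
    using assms(2) t \<xi> by (intro partial_deriv_cong_open[of "- {0}"]) (auto simp: pos_homogeneous_def)
  also have "\<dots> = of_real t powr b * partial_deriv i h \<xi>"
    using diff[OF \<xi>] by (intro partial_deriv_bounded_linear bounded_linear_mult_right)
  finally have "of_real t * partial_deriv i h (t *\<^sub>R \<xi>) = of_real t powr b * partial_deriv i h \<xi>"
    by (simp add: scaleR_conv_of_real)
  then have "partial_deriv i h (t *\<^sub>R \<xi>) = (of_real t powr b / of_real t) * partial_deriv i h \<xi>"
    using t by (simp add: field_simps)
  also have "of_real t powr b / of_real t = complex_of_real t powr (b - 1)"
    using t by (simp add: powr_diff)
  finally show "partial_deriv i h (t *\<^sub>R \<xi>) = complex_of_real t powr (b - 1) * partial_deriv i h \<xi>" .
qed

section \<open>The cut-off regularised integral\<close>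

lemma set_integral_ball_tendsto:
  fixes g :: "'a::euclidean_space \<Rightarrow> 'b::{banach, second_countable_topology}"
  assumes g: "integrable lborel g"
  shows "((\<lambda>R. LINT x:ball 0 R|lborel. g x) \<longlongrightarrow> (\<integral>x. g x \<partial>lborel)) at_top"
  unfolding set_lebesgue_integral_def
proof (rule integral_dominated_convergence_at_top[where w = "\<lambda>x. norm (g x)"])
  show meas: "g \<in> borel_measurable lborel" using g by (rule borel_measurable_integrable)
  then show "(\<lambda>x. indicator (ball 0 R) x *\<^sub>R g x) \<in> borel_measurable lborel" for R
    by (intro borel_measurable_scaleR borel_measurable_indicator) auto
  show "integrable lborel (\<lambda>x. norm (g x))" using g by (rule integrable_norm)
  show "AE x in lborel. ((\<lambda>R. indicator (ball 0 R) x *\<^sub>R g x) \<longlongrightarrow> g x) at_top"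
  proof (rule AE_I2)
    fix x :: 'a
    have "\<forall>\<^sub>F R in at_top. indicator (ball 0 R) x *\<^sub>R g x = g x"
      using eventually_gt_at_top[of "norm x"] by eventually_elim simp
    then show "((\<lambda>R. indicator (ball 0 R) x *\<^sub>R g x) \<longlongrightarrow> g x) at_top"
      by (rule tendsto_eventually)
  qed
  show "\<forall>\<^sub>F R in at_top. AE x in lborel. norm (indicator (ball 0 R) x *\<^sub>R g x) \<le> norm (g x)"
    by (auto simp: indicator_def)
qed

lemma set_integrable_ball:
  fixes f :: "'a::euclidean_space \<Rightarrow> complex"
  assumes "continuous_on UNIV f"
  shows "set_integrable lborel (ball 0 R) f"
proof -
  have "set_integrable lborel (cball 0 R) f"
    unfolding set_integrable_def
    by (intro borel_integrable_compact continuous_on_subset[OF assms]) auto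
  then show ?thesis by (rule set_integrable_subset) auto
qed

section \<open>Existence of the constant term on divergences\<close>

lemma symbols_integrable:
  fixes f :: "real ^ 'n \<Rightarrow> complex"
  assumes "f \<in> symbols a" "Re a \<le> - real (CARD('n) + 2)"
  shows "integrable lborel f"
proof -
  have meas: "f \<in> borel_measurable borel"
    by (rule borel_measurable_smooth[OF symbols_smooth[OF assms(1)]])
  have "\<exists>C. \<forall>\<xi>. norm (partial_derivs [] f \<xi>) \<le> C * (1 + norm \<xi>) powr (Re a - real (length ([] :: 'n list)))"
    using assms(1) unfolding symbols_def by blast
  then obtain C where C: "\<And>\<xi>. norm (f \<xi>) \<le> C * (1 + norm \<xi>) powr Re a" by auto
  have "(1 + norm \<xi>) ^ (DIM(real ^ 'n) + 2) * norm (f \<xi>) \<le> \<bar>C\<bar>" for \<xi>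
  proof -
    have pos: "1 + norm \<xi> > 0" by (simp add: add_pos_nonneg)
    have "norm (f \<xi>) \<le> \<bar>C\<bar> * (1 + norm \<xi>) powr Re a"
      by (rule order_trans[OF C mult_right_mono]) auto
    also have "\<dots> \<le> \<bar>C\<bar> * (1 + norm \<xi>) powr (- real (CARD('n) + 2))"
      using assms(2) by (intro mult_left_mono powr_mono) auto
    also have "\<dots> = \<bar>C\<bar> / (1 + norm \<xi>) ^ (CARD('n) + 2)"
      unfolding powr_minus_divide using pos by (subst powr_realpow) auto
    finally show ?thesis using pos by (simp add: pos_le_divide_eq mult.commute)
  qed
  with meas show ?thesis by (rule integrable_decay)
qed

lemma ex_constant_term_partial_deriv:
  fixes \<tau> :: "real ^ 'n \<Rightarrow> complex"
  assumes \<psi>: "cutoff \<psi>" and \<tau>: "\<tau> \<in> CS b" "has_expansion \<psi> b \<tau> h"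
  shows "\<exists>c. is_constant_term (\<lambda>R. LINT \<xi>:ball 0 R|lborel. partial_deriv i \<tau> \<xi>) c"
proof -
  \<comment> \<open>Enough components are split off for the derivative of the remainder, of order b
    - N - 1, to fall below -(n + 2), the decay for which \<open>symbols_integrable\<close>
    applies.\<close>
  define N where "N = nat \<lceil>Re b + real (CARD('n) + 2)\<rceil>"
  define g where "g = (\<lambda>\<xi>. \<tau> \<xi> - (\<Sum>j<N. complex_of_real (\<psi> \<xi>) * h j \<xi>))"
  have h: "smooth_on (- {0}) (h j)" "pos_homogeneous (b - of_nat j) (h j)" for j
    using \<tau>(2) by (simp_all add: has_expansion_def)
  have g: "g \<in> symbols (b - of_nat N)"
    using \<tau>(2) by (simp add: has_expansion_def g_def)
  have dg_int: "integrable lborel (partial_deriv i g)"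
  proof (rule symbols_integrable[OF symbols_partial_deriv[OF g]])
    show "Re (b - of_nat N - 1) \<le> - real (CARD('n) + 2)"
      unfolding N_def by simp linarith
  qed
  have smooth_\<tau>: "smooth_on UNIV \<tau>" using \<tau>(1) CS_subset_symbols symbols_smooth by blast
  have cont_d\<tau>: "continuous_on UNIV (partial_deriv i \<tau>)"
    by (intro smooth_on_continuous_on smooth_on_partial_deriv smooth_\<tau>)
  have cont_dg: "continuous_on UNIV (partial_deriv i g)"
    by (intro smooth_on_continuous_on smooth_on_partial_deriv symbols_smooth[OF g])
  have cont_dh: "continuous_on (- {0}) (partial_deriv i (h j))" for j
    by (intro smooth_on_continuous_on smooth_on_partial_deriv h)
  \<comment> \<open>The inequality is strict because \<psi> is 1 on the complement of the open unit
    ball, while differentiating the identity requires an open set.\<close>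
  have outside: "partial_deriv i \<tau> x = (\<Sum>j<N. partial_deriv i (h j) x) + partial_deriv i g x"
    if "norm x > 1" for x
  proof -
    have "partial_deriv i \<tau> x = partial_deriv i (\<lambda>x. (\<Sum>j<N. h j x) + g x) x"
    proof (rule partial_deriv_cong_open)
      show "open (- cball (0 :: real ^ 'n) 1)" by (simp add: open_Compl)
      show "\<tau> y = (\<Sum>j<N. h j y) + g y" if "y \<in> - cball 0 1" for y
        using \<psi> that by (simp add: g_def cutoff_def)
    qed (use that in simp)
    also have "\<dots> = partial_deriv i (\<lambda>x. \<Sum>j<N. h j x) x + partial_deriv i g x"
    proof (rule partial_deriv_add)
      show "(\<lambda>x. \<Sum>j<N. h j x) differentiable (at x)"
        using that by (intro differentiable_sum ballI smooth_on_differentiable[OF h(1)]) auto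
    qed (rule smooth_on_differentiable[OF symbols_smooth[OF g] UNIV_I])
    also have "partial_deriv i (\<lambda>x. \<Sum>j<N. h j x) x = (\<Sum>j<N. partial_deriv i (h j) x)"
      using that by (intro partial_deriv_sum smooth_on_differentiable[OF h(1)]) auto
    finally show ?thesis .
  qed
  \<comment> \<open>The integral is split at radius 2, inside the region where
    \<open>outside\<close> holds, whereas the homogeneous integrals are normalised to inner radius
    1. \<open>k\<close> collects the inner ball and the resulting difference between radii 1 and
    2.\<close>
  define k where "k = (LINT x:ball 0 2|lborel. partial_deriv i \<tau> x)
    - (\<Sum>j<N. LINT x:annulus 1 2|lborel. partial_deriv i (h j) x)"
  \<comment> \<open>Truncating the remainder outside \<open>ball 0 2\<close> by an indicator
    replaces its annulus by a growing ball, over which the integral of an integrable function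
    converges.\<close>
  define G where "G R = k + (\<Sum>j<N. LINT x:annulus 1 R|lborel. partial_deriv i (h j) x)
    + (LINT x:ball 0 R|lborel. indicator (- ball 0 2) x *\<^sub>R partial_deriv i g x)" for R
  have split: "(LINT x:ball 0 R|lborel. partial_deriv i \<tau> x) = G R" if "R \<ge> 2" for R
  proof -
    have "(LINT x:ball 0 R|lborel. partial_deriv i \<tau> x)
        = (LINT x:ball 0 2|lborel. partial_deriv i \<tau> x) + (LINT x:annulus 2 R|lborel. partial_deriv i \<tau> x)"
    proof -
      have "ball 0 R = (ball 0 2 \<union> annulus 2 R :: (real ^ 'n) set)" "ball 0 2 \<inter> annulus 2 R = ({} :: (real ^ 'n) set)"
        using that subset_ball[of 2 R "0 :: real ^ 'n"] by (auto simp: annulus_def)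
      moreover have "set_integrable lborel (annulus 2 R) (partial_deriv i \<tau>)"
        by (rule set_integrable_annulus[OF continuous_on_subset[OF cont_d\<tau>]]) auto
      ultimately show ?thesis by (simp add: set_integral_Un set_integrable_ball[OF cont_d\<tau>])
    qed
    also have "(LINT x:annulus 2 R|lborel. partial_deriv i \<tau> x)
        = (LINT x:annulus 2 R|lborel. (\<Sum>j<N. partial_deriv i (h j) x) + partial_deriv i g x)"
      by (rule set_lebesgue_integral_cong) (auto simp: annulus_def intro!: outside)
    also have "\<dots> = (\<Sum>j<N. LINT x:annulus 2 R|lborel. partial_deriv i (h j) x)
        + (LINT x:annulus 2 R|lborel. partial_deriv i g x)"
    proof -
      have "set_integrable lborel (annulus 2 R) (partial_deriv i (h j))" for j
        by (rule set_integrable_annulus[OF cont_dh]) simp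
      moreover have "set_integrable lborel (annulus 2 R) (partial_deriv i g)"
        by (rule set_integrable_annulus[OF continuous_on_subset[OF cont_dg]]) auto
      ultimately show ?thesis
        unfolding set_integrable_def set_lebesgue_integral_def
        by (simp only: scaleR_add_right scaleR_sum_right Bochner_Integration.integral_add
            Bochner_Integration.integral_sum Bochner_Integration.integrable_sum)
    qed
    also have "(\<Sum>j<N. LINT x:annulus 2 R|lborel. partial_deriv i (h j) x)
        = (\<Sum>j<N. LINT x:annulus 1 R|lborel. partial_deriv i (h j) x)
          - (\<Sum>j<N. LINT x:annulus 1 2|lborel. partial_deriv i (h j) x)"
      unfolding sum_subtractf[symmetric]
    proof (rule sum.cong[OF refl])
      fix j
      show "(LINT x:annulus 2 R|lborel. partial_deriv i (h j) x)
        = (LINT x:annulus 1 R|lborel. partial_deriv i (h j) x) - (LINT x:annulus 1 2|lborel. partial_deriv i (h j) x)"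
        using set_integral_annulus_split[OF cont_dh[of j], of 1 2 R] that by simp
    qed
    also have "(LINT x:annulus 2 R|lborel. partial_deriv i g x)
        = (LINT x:ball 0 R|lborel. indicator (- ball 0 2) x *\<^sub>R partial_deriv i g x)"
      unfolding set_lebesgue_integral_def
      by (rule Bochner_Integration.integral_cong) (auto simp: annulus_def indicator_def)
    finally show ?thesis by (simp add: G_def k_def)
  qed
  have "\<exists>c. is_constant_term (\<lambda>R. \<Sum>j<N. LINT x:annulus 1 R|lborel. partial_deriv i (h j) x) c"
    by (rule ex_constant_term_sum)
      (rule ex_constant_term_homogeneous[OF cont_dh pos_homogeneous_partial_deriv[OF h]])
  then obtain c where c: "is_constant_term (\<lambda>R. \<Sum>j<N. LINT x:annulus 1 R|lborel. partial_deriv i (h j) x) c"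
    by blast
  have "integrable lborel (\<lambda>x. indicator (- ball 0 2) x *\<^sub>R partial_deriv i g x)"
    by (rule integrable_mult_indicator[OF _ dg_int]) simp
  from is_constant_term_tendsto[OF set_integral_ball_tendsto[OF this]]
  have "\<exists>c. is_constant_term G c"
    unfolding G_def[abs_def]
    by (intro exI) (rule is_constant_term_add[OF is_constant_term_add[OF
          is_constant_term_tendsto[OF tendsto_const] c]])
  then obtain d where d: "is_constant_term G d" by blast
  have "\<forall>\<^sub>F R in at_top. G R = (LINT x:ball 0 R|lborel. partial_deriv i \<tau> x)"
    using eventually_ge_at_top[of 2] by eventually_elim (rule split[symmetric])
  then show ?thesis by (intro exI) (rule is_constant_term_cong[OF _ d])
qed

lemma set_integral_ball_sum:
  fixes f :: "'b \<Rightarrow> 'a::euclidean_space \<Rightarrow> complex"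
  assumes "\<And>a. a \<in> A \<Longrightarrow> continuous_on UNIV (f a)"
  shows "(LINT \<xi>:ball 0 R|lborel. (\<Sum>a\<in>A. f a \<xi>)) = (\<Sum>a\<in>A. LINT \<xi>:ball 0 R|lborel. f a \<xi>)"
  using set_integrable_ball[OF assms, of _ R] unfolding set_integrable_def set_lebesgue_integral_def
  by (simp only: scaleR_sum_right Bochner_Integration.integral_sum)

lemma is_constant_term_smoothing:
  fixes r :: "real ^ 'n \<Rightarrow> complex"
  assumes "r \<in> smoothing"
  shows "is_constant_term (\<lambda>R. LINT \<xi>:ball 0 R|lborel. r \<xi>) (\<integral>\<xi>. r \<xi> \<partial>lborel)"
  by (intro is_constant_term_tendsto set_integral_ball_tendsto smoothing_integrable assms)

text \<open>The smoothing part contributes its ordinary integral. The divergence is a finite sum of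
  derivatives of classical symbols with expansions for the given \<psi>, each of which has a
  constant term.\<close>

lemma ex_constant_term_divergence_in:
  fixes \<sigma> :: "real ^ 'n \<Rightarrow> complex"
  assumes \<psi>: "cutoff \<psi>" and "divergence_in \<psi> S \<sigma>"
  shows "\<exists>c. is_constant_term (\<lambda>R. LINT \<xi>:ball 0 R|lborel. \<sigma> \<xi>) c"
proof -
  obtain T r where r: "r \<in> smoothing"
    and \<sigma>: "\<sigma> = (\<lambda>\<xi>. r \<xi> + (\<Sum>i\<in>UNIV. partial_deriv i (T i) \<xi>))"
    and T: "\<And>i. \<exists>(A :: complex set) \<tau>. finite A \<and> (\<forall>a\<in>A. \<exists>b h. \<tau> a \<in> CS b \<and> has_expansion \<psi> b (\<tau> a) h) \<and>
      partial_deriv i (T i) = (\<lambda>\<xi>. \<Sum>a\<in>A. partial_deriv i (\<tau> a) \<xi>)"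
    by (rule divergence_in_decomposition[OF assms]) blast
  have dT: "continuous_on UNIV (partial_deriv i (T i)) \<and>
      (\<exists>c. is_constant_term (\<lambda>R. LINT \<xi>:ball 0 R|lborel. partial_deriv i (T i) \<xi>) c)" for i
  proof -
    obtain A :: "complex set" and \<tau> where
      \<tau>: "\<forall>a\<in>A. \<exists>b h. \<tau> a \<in> CS b \<and> has_expansion \<psi> b (\<tau> a) h"
      and eq: "partial_deriv i (T i) = (\<lambda>\<xi>. \<Sum>a\<in>A. partial_deriv i (\<tau> a) \<xi>)"
      using T[of i] by blast
    have cont: "continuous_on UNIV (partial_deriv i (\<tau> a))" if "a \<in> A" for a
    proof -
      have "smooth_on UNIV (\<tau> a)" using \<tau> that CS_subset_symbols symbols_smooth by blast
      then show ?thesis by (intro smooth_on_continuous_on smooth_on_partial_deriv)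
    qed
    have ct: "\<exists>c. is_constant_term (\<lambda>R. LINT \<xi>:ball 0 R|lborel. partial_deriv i (\<tau> a) \<xi>) c" if "a \<in> A" for a
      using \<tau> that ex_constant_term_partial_deriv[OF \<psi>] by blast
    have "\<exists>c. is_constant_term (\<lambda>R. \<Sum>a\<in>A. LINT \<xi>:ball 0 R|lborel. partial_deriv i (\<tau> a) \<xi>) c"
      by (rule ex_constant_term_sum) (rule ct)
    then show ?thesis
      unfolding eq by (simp only: set_integral_ball_sum[OF cont] continuous_on_sum[OF cont] simp_thms)
  qed
  have "\<exists>c. is_constant_term (\<lambda>R. \<Sum>i\<in>UNIV. LINT \<xi>:ball 0 R|lborel. partial_deriv i (T i) \<xi>) c"
    by (rule ex_constant_term_sum) (use dT in blast)
  then obtain c where c: "is_constant_term (\<lambda>R. \<Sum>i\<in>UNIV. LINT \<xi>:ball 0 R|lborel. partial_deriv i (T i) \<xi>) c"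
    by blast
  have cont: "continuous_on UNIV r" "continuous_on UNIV (\<lambda>\<xi>. \<Sum>i\<in>UNIV. partial_deriv i (T i) \<xi>)"
    using dT by (auto intro: smooth_on_continuous_on smoothing_smooth r continuous_on_sum)
  have "(LINT \<xi>:ball 0 R|lborel. \<sigma> \<xi>) = (LINT \<xi>:ball 0 R|lborel. r \<xi>)
      + (\<Sum>i\<in>UNIV. LINT \<xi>:ball 0 R|lborel. partial_deriv i (T i) \<xi>)" for R
    unfolding \<sigma> using dT cont
    by (simp add: set_integral_add set_integrable_ball set_integral_ball_sum)
  with is_constant_term_add[OF is_constant_term_smoothing[OF r] c] show ?thesis by auto
qed

text \<open>A definite description can be computed only where its object exists, so existence is
  required on all of \<open>S\<close>. For a combination, the combined constant term is exhibited
  and uniqueness identifies it. Continuity allows the integrals over balls to be split.\<close>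

lemma linear_form_on_cutoff_integral:
  fixes S :: "(real ^ 'n \<Rightarrow> complex) set"
  assumes "\<And>\<sigma>. \<sigma> \<in> S \<Longrightarrow> continuous_on UNIV \<sigma>"
    and "\<And>\<sigma>. \<sigma> \<in> S \<Longrightarrow> \<exists>c. is_constant_term (\<lambda>R. LINT \<xi>:ball 0 R|lborel. \<sigma> \<xi>) c"
  shows "linear_form_on S cutoff_integral"
  unfolding linear_form_on_def
proof (intro allI ballI impI)
  fix \<alpha> \<beta> \<sigma> \<tau> assume S: "\<sigma> \<in> S" "\<tau> \<in> S"
  obtain c d where c: "is_constant_term (\<lambda>R. LINT \<xi>:ball 0 R|lborel. \<sigma> \<xi>) c"
    and d: "is_constant_term (\<lambda>R. LINT \<xi>:ball 0 R|lborel. \<tau> \<xi>) d"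
    using assms(2) S by blast
  have int: "set_integrable lborel (ball 0 R) \<sigma>" "set_integrable lborel (ball 0 R) \<tau>" for R
    using S by (auto intro: set_integrable_ball assms(1))
  have "(LINT \<xi>:ball 0 R|lborel. \<alpha> * \<sigma> \<xi> + \<beta> * \<tau> \<xi>)
      = \<alpha> * (LINT \<xi>:ball 0 R|lborel. \<sigma> \<xi>) + \<beta> * (LINT \<xi>:ball 0 R|lborel. \<tau> \<xi>)" for R
    using int by (simp add: set_integral_add)
  moreover have "is_constant_term (\<lambda>R. \<alpha> * (LINT \<xi>:ball 0 R|lborel. \<sigma> \<xi>) + \<beta> * (LINT \<xi>:ball 0 R|lborel. \<tau> \<xi>))
      (\<alpha> * c + \<beta> * d)"
    by (intro is_constant_term_add is_constant_term_scale c d)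
  ultimately have "cutoff_integral (\<lambda>\<xi>. \<alpha> * \<sigma> \<xi> + \<beta> * \<tau> \<xi>) = \<alpha> * c + \<beta> * d"
    by (intro cutoff_integral_eq) simp
  then show "cutoff_integral (\<lambda>\<xi>. \<alpha> * \<sigma> \<xi> + \<beta> * \<tau> \<xi>) = \<alpha> * cutoff_integral \<sigma> + \<beta> * cutoff_integral \<tau>"
    using cutoff_integral_eq[OF c] cutoff_integral_eq[OF d] by simp
qed

section \<open>Stokes forms are proportional to the integral\<close>

lemma stokes_form_on_smoothing:
  fixes S :: "(real ^ 'n \<Rightarrow> complex) set" and \<psi> :: "real ^ 'n \<Rightarrow> real"
  assumes \<psi>: "cutoff \<psi>" and S: "smoothing \<subseteq> S"
    and \<rho>: "linear_form_on S \<rho>" "stokes_on S \<rho>"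
  shows "\<exists>c. \<forall>r\<in>smoothing. \<rho> r = c * (\<integral>\<xi>. r \<xi> \<partial>lborel)"
proof -
  obtain \<phi> :: "real ^ 'n \<Rightarrow> complex" where \<phi>: "\<phi> \<in> smoothing" "(\<integral>\<xi>. \<phi> \<xi> \<partial>lborel) \<noteq> 0"
    using ex_smoothing_integral_nonzero[OF \<psi>] by blast
  \<comment> \<open>All functions involved stay smoothing, so every partial sum and multiple lies in
    \<open>S\<close>, and \<rho> ignores the divergence.\<close>
  have div: "\<rho> (\<lambda>\<xi>. k * f \<xi> + (\<Sum>i\<in>UNIV. partial_deriv i (F i) \<xi>)) = k * \<rho> f"
    if "f \<in> smoothing" "\<And>i. F i \<in> smoothing" for f k F
  proof -
    have sums: "(\<lambda>\<xi>. \<Sum>i\<in>J. partial_deriv i (F i) \<xi>) \<in> smoothing" for J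
      by (intro smoothing_sum[OF \<psi>] smoothing_partial_deriv[OF \<psi>] that)
    have kf: "(\<lambda>\<xi>. k * f \<xi>) \<in> smoothing" by (intro smoothing_scale[OF \<psi>] that)
    have "\<rho> (partial_deriv i (F i)) = 0" for i
      using \<rho>(2) that(2)[of i] smoothing_partial_deriv[OF \<psi> that(2), of i i] S smoothing_subset_CS_alg
      unfolding stokes_on_def by blast
    moreover have "\<rho> (\<lambda>\<xi>. \<Sum>i\<in>UNIV. partial_deriv i (F i) \<xi>) = (\<Sum>i\<in>UNIV. \<rho> (partial_deriv i (F i)))"
      using sums S by (intro linear_form_on_sum[OF \<rho>(1)]) auto
    moreover have "\<rho> (\<lambda>\<xi>. k * f \<xi> + (\<Sum>i\<in>UNIV. partial_deriv i (F i) \<xi>))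
        = \<rho> (\<lambda>\<xi>. k * f \<xi>) + \<rho> (\<lambda>\<xi>. \<Sum>i\<in>UNIV. partial_deriv i (F i) \<xi>)"
      using smoothing_add[OF \<psi> kf sums[of UNIV]] kf sums[of UNIV] S
      by (intro linear_form_on_add[OF \<rho>(1)]) auto
    moreover have "\<rho> (\<lambda>\<xi>. k * f \<xi>) = k * \<rho> f"
      using kf that(1) S by (intro linear_form_on_scale[OF \<rho>(1)]) auto
    ultimately show ?thesis by simp
  qed
  have "\<rho> r = (\<rho> \<phi> / (\<integral>\<xi>. \<phi> \<xi> \<partial>lborel)) * (\<integral>\<xi>. r \<xi> \<partial>lborel)" if r: "r \<in> smoothing" for r
  proof -
    obtain F G where FG: "\<And>i. F i \<in> smoothing" "\<And>i. G i \<in> smoothing"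
      "\<And>x. (\<integral>y. \<phi> y \<partial>lborel) * r x + (\<Sum>i\<in>UNIV. partial_deriv i (F i) x)
        = (\<integral>y. r y \<partial>lborel) * \<phi> x + (\<Sum>i\<in>UNIV. partial_deriv i (G i) x)"
      using smoothing_proportional_mod_divergence[OF \<psi> r \<phi>(1)] by blast
    \<comment> \<open>By \<open>FG(3)\<close> the two instances of \<open>div\<close> evaluate
      \<rho> at one and the same function.\<close>
    have "(\<integral>y. \<phi> y \<partial>lborel) * \<rho> r = (\<integral>y. r y \<partial>lborel) * \<rho> \<phi>"
      using div[where f = r and F = F and k = "\<integral>y. \<phi> y \<partial>lborel", OF r FG(1)]
        div[where f = \<phi> and F = G and k = "\<integral>y. r y \<partial>lborel", OF \<phi>(1) FG(2)]
      unfolding FG(3) by simp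
    with \<phi>(2) show ?thesis by (simp add: field_simps)
  qed
  then show ?thesis by blast
qed

theorem theorem2:
  fixes S :: "(real ^ 'n::{finite,linorder} \<Rightarrow> complex) set"
    and \<psi> :: "real ^ 'n::{finite,linorder} \<Rightarrow> real"
  assumes "CARD('n) \<ge> 2"
    and "cutoff \<psi>"
    and "smoothing \<subseteq> S"
    and "S \<subseteq> ker_res"
    and "\<forall>\<sigma>\<in>S. divergence_in \<psi> S \<sigma>"
  shows "(\<forall>K::nat. 1 \<le> K \<and> K \<le> CARD('n) \<longrightarrow>
      (\<forall>\<rho>\<^sub>1 \<rho>\<^sub>2. linear_form_on S \<rho>\<^sub>1 \<and> stokes_on S \<rho>\<^sub>1 \<and>
          linear_form_on S \<rho>\<^sub>2 \<and> stokes_on S \<rho>\<^sub>2 \<and>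
          (\<forall>\<sigma>\<in>S \<inter> CS_less (- real K). \<rho>\<^sub>1 \<sigma> = \<rho>\<^sub>2 \<sigma>) \<longrightarrow>
        (\<forall>\<sigma>\<in>S. \<rho>\<^sub>1 \<sigma> = \<rho>\<^sub>2 \<sigma>)) \<and>
      (\<forall>\<rho>\<^sub>1 \<rho>\<^sub>2. linear_form_on S \<rho>\<^sub>1 \<and> closed_on S (form_extension \<rho>\<^sub>1) \<and>
          linear_form_on S \<rho>\<^sub>2 \<and> closed_on S (form_extension \<rho>\<^sub>2) \<and>
          (\<forall>\<omega>\<in>forms (S \<inter> CS_less (- real K)). form_extension \<rho>\<^sub>1 \<omega> = form_extension \<rho>\<^sub>2 \<omega>) \<longrightarrow>
        (\<forall>\<omega>\<in>forms S. form_extension \<rho>\<^sub>1 \<omega> = form_extension \<rho>\<^sub>2 \<omega>))) \<and>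
    (stokes_on S cutoff_integral \<longrightarrow>
      (\<forall>\<rho>. linear_form_on S \<rho> \<and> stokes_on S \<rho> \<and>
          (\<forall>a. continuous_map (subtopology (CS_topology \<psi> a) (S \<inter> CS a)) euclidean \<rho>) \<longrightarrow>
        (\<exists>c. \<forall>\<sigma>\<in>S. \<rho> \<sigma> = c * cutoff_integral \<sigma>)))"
proof -
  note \<psi> = assms(2) and smoothing_S = assms(3) and div = assms(5)[rule_format]
  have alg: "S \<subseteq> CS_alg" using assms(4) by (auto simp: ker_res_def)
  have smoothing_less: "smoothing \<subseteq> CS_less p" for p
  proof -
    have "CS (of_real (p - 1)) \<subseteq> CS_less p"
      unfolding CS_less_def by (rule UN_upper) simp
    then show ?thesis by (auto simp: smoothing_def)
  qed
  have zero: "(\<lambda>_ :: (real, 'n) vec. 0) \<in> CS_alg"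
    using smoothing_zero[OF \<psi>] smoothing_subset_CS_alg by blast
  note determined = stokes_determined_by_smoothing[OF \<psi> smoothing_S alg _ div]
  have stokes_case: "\<rho>\<^sub>1 \<sigma> = \<rho>\<^sub>2 \<sigma>"
    if "linear_form_on S \<rho>\<^sub>1" "stokes_on S \<rho>\<^sub>1" "linear_form_on S \<rho>\<^sub>2" "stokes_on S \<rho>\<^sub>2"
      and eq: "\<forall>\<sigma>\<in>S \<inter> CS_less (- real K). \<rho>\<^sub>1 \<sigma> = \<rho>\<^sub>2 \<sigma>" and \<sigma>: "\<sigma> \<in> S" for K \<rho>\<^sub>1 \<rho>\<^sub>2 \<sigma>
  proof (rule determined[OF \<sigma> \<sigma> that(1-4)])
    fix r :: "(real, 'n) vec \<Rightarrow> complex" assume "r \<in> smoothing"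
    then show "\<rho>\<^sub>1 r = \<rho>\<^sub>2 r" using eq smoothing_S smoothing_less by blast
  qed
  have form_case: "form_extension \<rho>\<^sub>1 \<omega> = form_extension \<rho>\<^sub>2 \<omega>"
    if "linear_form_on S \<rho>\<^sub>1" "closed_on S (form_extension \<rho>\<^sub>1)"
      "linear_form_on S \<rho>\<^sub>2" "closed_on S (form_extension \<rho>\<^sub>2)"
      and eq: "\<forall>\<omega>\<in>forms (S \<inter> CS_less (- real K)). form_extension \<rho>\<^sub>1 \<omega> = form_extension \<rho>\<^sub>2 \<omega>"
      and \<omega>: "\<omega> \<in> forms S" for K \<rho>\<^sub>1 \<rho>\<^sub>2 \<omega>
  proof -
    have "\<forall>\<sigma>\<in>S \<inter> CS_less (- real K). \<rho>\<^sub>1 \<sigma> = \<rho>\<^sub>2 \<sigma>"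
    proof
      fix \<sigma> assume "\<sigma> \<in> S \<inter> CS_less (- real K)"
      \<comment> \<open>Repeating \<sigma> as the coefficient for every index set keeps all
        coefficients in the restricted class; only the top one enters the extension.\<close>
      then have "(\<lambda>_. \<sigma>) \<in> forms (S \<inter> CS_less (- real K))" by (simp add: forms_def)
      with eq show "\<rho>\<^sub>1 \<sigma> = \<rho>\<^sub>2 \<sigma>" by (auto simp: form_extension_eq)
    qed
    with stokes_case[OF that(1) closed_on_imp_stokes_on[OF zero that(2)] that(3)
        closed_on_imp_stokes_on[OF zero that(4)]] \<omega>
    show ?thesis by (simp add: form_extension_eq forms_def)
  qed
  have cutoff_case: "\<exists>c. \<forall>\<sigma>\<in>S. \<rho> \<sigma> = c * cutoff_integral \<sigma>"
    if cutoff: "stokes_on S cutoff_integral" and \<rho>: "linear_form_on S \<rho>" "stokes_on S \<rho>" for \<rho>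
  proof -
    obtain c where c: "\<And>r. r \<in> smoothing \<Longrightarrow> \<rho> r = c * (\<integral>\<xi>. r \<xi> \<partial>lborel)"
      using stokes_form_on_smoothing[OF \<psi> smoothing_S \<rho>] by blast
    have "linear_form_on S cutoff_integral"
      using alg by (intro linear_form_on_cutoff_integral CS_alg_continuous
          ex_constant_term_divergence_in[OF \<psi> div]) auto
    then have lin: "linear_form_on S (\<lambda>\<sigma>. c * cutoff_integral \<sigma>)"
      by (simp add: linear_form_on_def distrib_left mult.left_commute)
    have stokes: "stokes_on S (\<lambda>\<sigma>. c * cutoff_integral \<sigma>)"
      using cutoff by (simp add: stokes_on_def)
    \<comment> \<open>Both sides are linear forms with Stokes' property, so they need only agree on
      smoothing symbols. There the integrals over balls converge and the cut-off integral is the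
      ordinary one.\<close>
    have "\<rho> \<sigma> = c * cutoff_integral \<sigma>" if "\<sigma> \<in> S" for \<sigma>
    proof (rule determined[OF that that \<rho> lin stokes])
      fix r :: "(real, 'n) vec \<Rightarrow> complex" assume r: "r \<in> smoothing"
      show "\<rho> r = c * cutoff_integral r"
        using c[OF r] cutoff_integral_eq[OF is_constant_term_smoothing[OF r]] by simp
    qed
    then show ?thesis by blast
  qed
  show ?thesis
    using stokes_case form_case cutoff_case by blast
qed

end
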